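(* Fix a finite monoidal signature $\Sigma$. Given HARs $f$ of type $n_1\to m_1$ and $g$ of type $n_2\to m_2$ over $\Sigma$, of sizes $f_K$ and $g_K$, the tensor product HAR $f\otimes g$ can be computed in time $O(f_K+g_K)$, where the implied constant depends only on $\Sigma$.
   Context: Cost model: unit-cost RAM, with all matrices stored in a sparse row-wise format (for each row, the list of its non-zero entries with their column indices) and label vectors stored as arrays. A monoidal signature $\Sigma$ is a set of operations $o:n\to m$, each with an arity $n\in\mathbb N$ and a coarity $m\in\mathbb N$. Matrix conventions. $\mathsf{Mat}_S(n,m)$ is the set of $m\times n$ matrices over the semiring $S$ ($S=\mathbb B$ or $\mathbb N$), regarded as maps $n\to m$; composition is written in diagrammatic order, so $A;B$ is the ordinary matrix product $BA$. $A\oplus B$ is the block-diagonal direct sum, and $\sigma_{a,b}:a+b\to b+a$ is the permutation matrix $\begin{pmatrix}0&\mathrm{id}_b\\ \mathrm{id}_a&0\end{pmatrix}$. A matrix $M\in\mathsf{Mat}_{\mathbb N}(K,K)$ represents a directed graph with edge labels on vertices $1,\dots,K$: there is an edge $j\to i$ exactly when $M_{ij}\neq 0$, and its label is $M_{ij}$. HARs. A HAR (hypergraph adjacency representation) $f$ of type $n\to m$ over $\Sigma$ consists of a size $f_K=K\in\mathbb N$, a matrix $f_M=M\in\mathsf{Mat}_{\mathbb N}(K,K)$, permutation matrices $f_L=L,\ f_R=R\in\mathsf{Mat}_{\mathbb B}(K,K)$, and node labels $f_N=N\in(\{\bullet\}+(\{\circ\}\times\Sigma))^K$, such that: the graph of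 $M$ is acyclic and bipartite (every edge joins a $\bullet$-vertex and a $\circ$-vertex); every $\bullet$-vertex has at most one incoming and at most one outgoing edge; calling the $\bullet$-vertices without incoming edges the left interface nodes and the $\bullet$-vertices without outgoing edges the right interface nodes, there are exactly $n$ left interface nodes and they are the first $n$ vertices in the reordered matrix $L^T;M;L$, and there are exactly $m$ right interface nodes and they are the last $m$ vertices in the reordered matrix $R^T;M;R$; and each vertex labeled $(\circ,g)$ with $g:a\to b$ in $\Sigma$ has exactly $a$ incoming edges, labeled $1,\dots,a$, and exactly $b$ outgoing edges, labeled $1,\dots,b$ (each label occurring once). Tensor product of $f:n_1\to m_1$ and $g:n_2\to m_2$: $(f\otimes g)_M=f_M\oplus g_M$; $(f\otimes g)_L=(f_L\oplus g_L);(\mathrm{id}_{n_1}\oplus\sigma_{f_K-n_1,\,n_2}\oplus\mathrm{id}_{g_K-n_2})$; $(f\otimes g)_R=(f_R\oplus g_R);(\mathrm{id}_{f_K-m_1}\oplus\sigma_{m_1,\,g_K-m_2}\oplus\mathrm{id}_{m_2})$; $(f\otimes g)_N$ is $f_N$ followed by $g_N$. *)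

theory Defs
  imports "Jordan_Normal_Form.Matrix"
begin

section \<open>Monoidal signatures and matrices\<close>

record 'o signature =
  ops :: "'o set"
  arity :: "'o \<Rightarrow> nat"
  coarity :: "'o \<Rightarrow> nat"

text \<open>The Boolean semiring, so that \<^typ>\<open>bool mat\<close> carries the usual matrix operations.\<close>

instantiation bool :: comm_semiring_1
begin
definition zero_bool :: bool where "0 = False"
definition one_bool :: bool where "1 = True"
definition plus_bool :: "bool \<Rightarrow> bool \<Rightarrow> bool" where "a + b = (a \<or> b)"
definition times_bool :: "bool \<Rightarrow> bool \<Rightarrow> bool" where "a * b = (a \<and> b)"
instance
  by standard (auto simp: zero_bool_def one_bool_def plus_bool_def times_bool_def)
end

text \<open>
  A morphism \<open>n \<rightarrow> m\<close> is an \<open>m \<times> n\<close> matrix, that is, an element of \<open>carrier_mat m n\<close>;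
  composition is written in diagrammatic order. Vertices are numbered from 0, as are rows and columns.
\<close>

definition mat_seq :: "'a::semiring_0 mat \<Rightarrow> 'a mat \<Rightarrow> 'a mat"  (infixl \<open>;;\<close> 65) where
  "A ;; B = B * A"

definition mat_dsum :: "'a::zero mat \<Rightarrow> 'a mat \<Rightarrow> 'a mat"  (infixr \<open>\<oplus>\<^sub>m\<close> 70) where
  "A \<oplus>\<^sub>m B = four_block_mat A (0\<^sub>m (dim_row A) (dim_col B)) (0\<^sub>m (dim_row B) (dim_col A)) B"

definition mat_swap :: "nat \<Rightarrow> nat \<Rightarrow> 'a::{zero,one} mat"  (\<open>\<sigma>\<^sub>m\<close>) where
  "\<sigma>\<^sub>m a b = four_block_mat (0\<^sub>m b a) (1\<^sub>m b) (1\<^sub>m a) (0\<^sub>m a b)"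

definition permutation_mat :: "nat \<Rightarrow> bool mat \<Rightarrow> bool" where
  "permutation_mat k P \<longleftrightarrow> P \<in> carrier_mat k k \<and>
     (\<forall>i<k. \<exists>!j. j < k \<and> P $$ (i, j)) \<and> (\<forall>j<k. \<exists>!i. i < k \<and> P $$ (i, j))"

abbreviation bool_to_nat_mat :: "bool mat \<Rightarrow> nat mat" where
  "bool_to_nat_mat \<equiv> map_mat of_bool"

definition reorder_mat :: "bool mat \<Rightarrow> nat mat \<Rightarrow> nat mat" where
  "reorder_mat P M = transpose_mat (bool_to_nat_mat P) ;; M ;; bool_to_nat_mat P"

text \<open>The reordering \<open>P\<^sup>T;M;P\<close> moves vertex \<open>v\<close> of \<open>M\<close> to the position \<open>i\<close> with \<open>P $$ (i, v)\<close>.\<close>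

lemma reorder_mat_index:
  assumes P: "permutation_mat k P" and M: "M \<in> carrier_mat k k"
    and i: "i < k" "v < k" "P $$ (i, v)" and j: "j < k" "w < k" "P $$ (j, w)"
  shows "reorder_mat P M $$ (i, j) = M $$ (v, w)"
proof -
  have Pc: "P \<in> carrier_mat k k" using P by (simp add: permutation_mat_def)
  have row: "P $$ (a, x) \<longleftrightarrow> x = b" if "P $$ (a, b)" "a < k" "b < k" "x < k" for a b x
    using P that unfolding permutation_mat_def by blast
  let ?P = "bool_to_nat_mat P"
  have 1: "(M * transpose_mat ?P) $$ (x, j) = M $$ (x, w)" if "x < k" for x
  proof -
    have "(M * transpose_mat ?P) $$ (x, j) = (\<Sum>y<k. M $$ (x, y) * of_bool (P $$ (j, y)))"
      using that j M Pc by (auto simp: scalar_prod_def lessThan_atLeast0 intro!: sum.cong)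
    also have "\<dots> = (\<Sum>y<k. if y = w then M $$ (x, y) else 0)"
      using row[OF j(3,1,2)] by (intro sum.cong) auto
    also have "\<dots> = M $$ (x, w)" using j(2) by simp
    finally show ?thesis .
  qed
  have "reorder_mat P M $$ (i, j) = (?P * (M * transpose_mat ?P)) $$ (i, j)"
    by (simp add: reorder_mat_def mat_seq_def)
  also have "\<dots> = (\<Sum>x<k. of_bool (P $$ (i, x)) * (M * transpose_mat ?P) $$ (x, j))"
    using i j M Pc
    by (subst index_mult_mat) (auto simp: scalar_prod_def lessThan_atLeast0 intro!: sum.cong)
  also have "\<dots> = (\<Sum>x<k. if x = v then M $$ (x, w) else 0)"
    using row[OF i(3,1,2)] 1 by (intro sum.cong) auto
  also have "\<dots> = M $$ (v, w)" using i(2) by simp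
  finally show ?thesis .
qed


section \<open>Hypergraph adjacency representations\<close>

datatype 'o node = Bullet | Circ 'o

record 'o har =
  har_size :: nat
  har_mat :: "nat mat"
  har_left :: "bool mat"
  har_right :: "bool mat"
  har_lab :: "'o node list"

definition har_edges :: "'o har \<Rightarrow> (nat \<times> nat) set" where
  "har_edges f = {(j, i). j < har_size f \<and> i < har_size f \<and> har_mat f $$ (i, j) \<noteq> 0}"

definition left_nodes :: "'o har \<Rightarrow> nat set" where
  "left_nodes f = {v. v < har_size f \<and> har_lab f ! v = Bullet \<and> (\<forall>j. (j, v) \<notin> har_edges f)}"

definition right_nodes :: "'o har \<Rightarrow> nat set" where
  "right_nodes f = {v. v < har_size f \<and> har_lab f ! v = Bullet \<and> (\<forall>i. (v, i) \<notin> har_edges f)}"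

text \<open>\<open>is_har \<Sigma> n m f\<close>: \<open>f\<close> is a HAR of type \<open>n \<rightarrow> m\<close> over \<open>\<Sigma>\<close>.\<close>

definition is_har :: "'o signature \<Rightarrow> nat \<Rightarrow> nat \<Rightarrow> 'o har \<Rightarrow> bool" where
  "is_har \<Sigma> n m f \<longleftrightarrow>
     (let K = har_size f; M = har_mat f; L = har_left f; R = har_right f; N = har_lab f;
          E = har_edges f
      in M \<in> carrier_mat K K \<and> permutation_mat K L \<and> permutation_mat K R \<and> length N = K \<and>
         acyclic E \<and>
         (\<forall>(j, i) \<in> E. (N ! j = Bullet) \<noteq> (N ! i = Bullet)) \<and>
         (\<forall>v<K. N ! v = Bullet \<longrightarrow> card {j. (j, v) \<in> E} \<le> 1 \<and> card {i. (v, i) \<in> E} \<le> 1) \<and>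
         card (left_nodes f) = n \<and> left_nodes f = {v. v < K \<and> (\<exists>i<n. L $$ (i, v))} \<and>
         card (right_nodes f) = m \<and>
         right_nodes f = {v. v < K \<and> (\<exists>i. K - m \<le> i \<and> i < K \<and> R $$ (i, v))} \<and>
         (\<forall>v<K. \<forall>g. N ! v = Circ g \<longrightarrow> g \<in> ops \<Sigma> \<and>
            bij_betw (\<lambda>j. M $$ (v, j)) {j. (j, v) \<in> E} {1..arity \<Sigma> g} \<and>
            bij_betw (\<lambda>i. M $$ (i, v)) {i. (v, i) \<in> E} {1..coarity \<Sigma> g}))"

definition har_tensor ::
  "nat \<Rightarrow> nat \<Rightarrow> nat \<Rightarrow> nat \<Rightarrow> 'o har \<Rightarrow> 'o har \<Rightarrow> 'o har" where
  "har_tensor n1 m1 n2 m2 f g =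
     \<lparr>har_size = har_size f + har_size g,
      har_mat = har_mat f \<oplus>\<^sub>m har_mat g,
      har_left = (har_left f \<oplus>\<^sub>m har_left g) ;;
        (1\<^sub>m n1 \<oplus>\<^sub>m \<sigma>\<^sub>m (har_size f - n1) n2 \<oplus>\<^sub>m 1\<^sub>m (har_size g - n2)),
      har_right = (har_right f \<oplus>\<^sub>m har_right g) ;;
        (1\<^sub>m (har_size f - m1) \<oplus>\<^sub>m \<sigma>\<^sub>m m1 (har_size g - m2) \<oplus>\<^sub>m 1\<^sub>m m2),
      har_lab = har_lab f @ har_lab g\<rparr>"


subsection \<open>The tensor product of HARs is a HAR\<close>

text \<open>\<open>block_perm a b c\<close> is the index map of the permutation matrices in the definition of \<open>har_tensor\<close>.\<close>

lemma mat_dsum_dim[simp]: "dim_row (A \<oplus>\<^sub>m B) = dim_row A + dim_row B" "dim_col (A \<oplus>\<^sub>m B) = dim_col A + dim_col B"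
  by (auto simp: mat_dsum_def)

lemma mat_dsum_index: "i < dim_row A + dim_row B \<Longrightarrow> j < dim_col A + dim_col B \<Longrightarrow>
  (A \<oplus>\<^sub>m B) $$ (i,j) = (if i < dim_row A then if j < dim_col A then A $$ (i,j) else 0
     else if j < dim_col A then 0 else B $$ (i - dim_row A, j - dim_col A))"
  by (auto simp: mat_dsum_def)

lemma mat_swap_dim[simp]: "dim_row (\<sigma>\<^sub>m a b) = a+b" "dim_col (\<sigma>\<^sub>m a b) = a+b"
  by (auto simp: mat_swap_def)

lemma mat_swap_index: "i < a+b \<Longrightarrow> j < a+b \<Longrightarrow> (\<sigma>\<^sub>m a b :: bool mat) $$ (i,j) \<longleftrightarrow> (if i < b then j = i + a else i = j + b)"
  by (auto simp: mat_swap_def zero_bool_def one_bool_def)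

definition block_perm :: "nat \<Rightarrow> nat \<Rightarrow> nat \<Rightarrow> nat \<Rightarrow> nat" where
  "block_perm a b c i = (if i < a then i else if i < a+c then i+b else if i < a+b+c then i-c else i)"

lemma block_perm_mat_index: "i < a+b+c+d \<Longrightarrow> j < a+b+c+d \<Longrightarrow>
  (1\<^sub>m a \<oplus>\<^sub>m \<sigma>\<^sub>m b c \<oplus>\<^sub>m 1\<^sub>m d :: bool mat) $$ (i,j) \<longleftrightarrow> j = block_perm a b c i"
  by (cases "i < a"; cases "j < a")
     (auto simp: mat_dsum_index zero_bool_def one_bool_def mat_swap_index block_perm_def)

lemma sum_bool_iff: "finite A \<Longrightarrow> sum f A = (\<exists>x\<in>A. (f x :: bool))"
  by (induction A rule: finite_induct) (auto simp: zero_bool_def plus_bool_def)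

lemma bool_mat_mult_index: "i < dim_row Q \<Longrightarrow> v < dim_col B \<Longrightarrow> dim_col Q = dim_row B \<Longrightarrow>
   ((Q * B :: bool mat) $$ (i,v)) \<longleftrightarrow> (\<exists>x<dim_row B. Q $$ (i,x) \<and> B $$ (x,v))"
  by (auto simp: scalar_prod_def sum_bool_iff times_bool_def)

lemma permutation_mat_carrier: "permutation_mat k P \<Longrightarrow> P \<in> carrier_mat k k" by (simp only: permutation_mat_def)
lemma permutation_mat_row: "permutation_mat k P \<Longrightarrow> i < k \<Longrightarrow> \<exists>!j. j < k \<and> P $$ (i,j)" by (simp only: permutation_mat_def)
lemma permutation_mat_col: "permutation_mat k P \<Longrightarrow> i < k \<Longrightarrow> \<exists>!j. j < k \<and> P $$ (j,i)" by (simp only: permutation_mat_def)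
lemma ex1_less_imp: "\<exists>!j. j < k \<and> P j \<Longrightarrow> \<exists>j. j < (k::nat) \<and> P j \<and> (\<forall>j'. j' < k \<and> P j' \<longrightarrow> j' = j)" by blast
lemma ex1_less_shift:
  assumes "\<exists>!j. j < l \<and> P j" shows "\<exists>!j. j < k+l \<and> k \<le> j \<and> P (j-(k::nat))"
proof -
  obtain j where j: "j < l" "P j" and u: "\<forall>j'. j' < l \<and> P j' \<longrightarrow> j' = j" using ex1_less_imp[OF assms] by blast
  show ?thesis
  proof (rule ex1I[of _ "j+k"])
    show "j+k < k+l \<and> k \<le> j+k \<and> P (j+k-k)" using j by simp
    fix y assume "y < k+l \<and> k \<le> y \<and> P (y-k)"
    then have y: "k \<le> y" "y - k < l" "P (y-k)" by auto
    then have "y - k = j" using u[rule_format, of "y-k"] by blast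
    then show "y = j+k" using y by simp
  qed
qed

lemma permutation_mat_dsum:
  assumes "permutation_mat k A" "permutation_mat l B"
  shows "permutation_mat (k+l) (A \<oplus>\<^sub>m B)"
proof -
  have d: "dim_row A = k" "dim_col A = k" "dim_row B = l" "dim_col B = l"
    using assms[THEN permutation_mat_carrier] by auto
  have e: "(A \<oplus>\<^sub>m B) $$ (i,j) \<longleftrightarrow> (if i < k then j < k \<and> A $$ (i,j) else k \<le> j \<and> B $$ (i-k,j-k))" if "i < k+l" "j < k+l" for i j
    using that d by (subst mat_dsum_index) (auto simp: zero_bool_def)
  have 1: "\<exists>!j. j < k+l \<and> (A \<oplus>\<^sub>m B) $$ (i,j)" if i: "i < k+l" for i
  proof (cases "i < k")
    case True
    have "(j < k+l \<and> (A \<oplus>\<^sub>m B) $$ (i,j)) \<longleftrightarrow> j < k \<and> A $$ (i,j)" for j using e[OF i, of j] True by auto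
    then show ?thesis using permutation_mat_row[OF assms(1) True] by simp
  next
    case False
    have "i - k < l" using False i by auto
    have "(j < k+l \<and> (A \<oplus>\<^sub>m B) $$ (i,j)) \<longleftrightarrow> j < k+l \<and> k \<le> j \<and> B $$ (i-k,j-k)" for j using e[OF i, of j] False by auto
    then show ?thesis using ex1_less_shift[OF permutation_mat_row[OF assms(2) \<open>i - k < l\<close>], of k] by simp
  qed
  have 2: "\<exists>!i. i < k+l \<and> (A \<oplus>\<^sub>m B) $$ (i,j)" if j: "j < k+l" for j
  proof (cases "j < k")
    case True
    have "(i < k+l \<and> (A \<oplus>\<^sub>m B) $$ (i,j)) \<longleftrightarrow> i < k \<and> A $$ (i,j)" for i using e[OF _ j, of i] True by (auto split: if_splits)
    then show ?thesis using permutation_mat_col[OF assms(1) True] by simp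
  next
    case False
    have "j - k < l" using False j by auto
    have "(i < k+l \<and> (A \<oplus>\<^sub>m B) $$ (i,j)) \<longleftrightarrow> i < k+l \<and> k \<le> i \<and> B $$ (i-k,j-k)" for i using e[OF _ j, of i] False by (auto split: if_splits)
    then show ?thesis using ex1_less_shift[OF permutation_mat_col[OF assms(2) \<open>j - k < l\<close>], of k] by simp
  qed
  have C: "A \<oplus>\<^sub>m B \<in> carrier_mat (k+l) (k+l)" using d by (intro carrier_matI) simp_all
  show ?thesis unfolding permutation_mat_def by (intro conjI allI impI C 1 2)
qed

lemma block_perm_bound: "i < a+b+c+d \<Longrightarrow> block_perm a b c i < a+b+c+d" by (auto simp: block_perm_def)
lemma block_perm_inverse: "i < a+b+c+d \<Longrightarrow> block_perm a c b (block_perm a b c i) = i" by (auto simp: block_perm_def)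

lemma block_perm_seq_index:
  assumes "B \<in> carrier_mat (a+b+c+d) (a+b+c+d)" "i < a+b+c+d" "v < a+b+c+d"
  shows "(B ;; (1\<^sub>m a \<oplus>\<^sub>m \<sigma>\<^sub>m b c \<oplus>\<^sub>m 1\<^sub>m d)) $$ (i,v) \<longleftrightarrow> (B $$ (block_perm a b c i, v) :: bool)"
  unfolding mat_seq_def using assms block_perm_bound[OF assms(2)]
  by (subst bool_mat_mult_index) (auto simp: block_perm_mat_index)

lemma permutation_mat_block_perm_seq:
  assumes B: "permutation_mat (a+b+c+d) B"
  shows "permutation_mat (a+b+c+d) (B ;; (1\<^sub>m a \<oplus>\<^sub>m \<sigma>\<^sub>m b c \<oplus>\<^sub>m 1\<^sub>m d))"
proof -
  let ?k = "a+b+c+d"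
  note Bc = permutation_mat_carrier[OF B]
  have 1: "\<exists>!j. j < ?k \<and> (B ;; (1\<^sub>m a \<oplus>\<^sub>m \<sigma>\<^sub>m b c \<oplus>\<^sub>m 1\<^sub>m d)) $$ (i,j)" if i: "i < ?k" for i
  proof -
    have "\<exists>!j. j < ?k \<and> B $$ (block_perm a b c i,j)" by (rule permutation_mat_row[OF B block_perm_bound[OF i]])
    moreover have "j < ?k \<and> (B ;; (1\<^sub>m a \<oplus>\<^sub>m \<sigma>\<^sub>m b c \<oplus>\<^sub>m 1\<^sub>m d)) $$ (i,j) \<longleftrightarrow> j < ?k \<and> B $$ (block_perm a b c i,j)" for j
      using block_perm_seq_index[OF Bc i] by auto
    ultimately show ?thesis by simp
  qed
  have 2: "\<exists>!i. i < ?k \<and> (B ;; (1\<^sub>m a \<oplus>\<^sub>m \<sigma>\<^sub>m b c \<oplus>\<^sub>m 1\<^sub>m d)) $$ (i,j)" if j: "j < ?k" for j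
  proof -
    obtain i where i: "i < ?k" "B $$ (i,j)" "\<And>i'. i' < ?k \<Longrightarrow> B $$ (i',j) \<Longrightarrow> i' = i"
    proof -
      have "\<exists>!i. i < ?k \<and> B $$ (i,j)" by (rule permutation_mat_col[OF B j])
      then show ?thesis by (elim ex1E conjE) (rule that, assumption, assumption, simp)
    qed
    have bnd: "block_perm a c b i < ?k" using block_perm_bound[of i a c b d] i(1) by (auto simp: algebra_simps)
    have qq: "block_perm a b c (block_perm a c b i) = i" using block_perm_inverse[of i a c b d] i(1) by (auto simp: algebra_simps)
    show ?thesis
    proof (rule ex1I[of _ "block_perm a c b i"])
      show "block_perm a c b i < ?k \<and> (B ;; (1\<^sub>m a \<oplus>\<^sub>m \<sigma>\<^sub>m b c \<oplus>\<^sub>m 1\<^sub>m d)) $$ (block_perm a c b i,j)"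
        using bnd block_perm_seq_index[OF Bc bnd j] qq i(2) by simp
      fix i' assume "i' < ?k \<and> (B ;; (1\<^sub>m a \<oplus>\<^sub>m \<sigma>\<^sub>m b c \<oplus>\<^sub>m 1\<^sub>m d)) $$ (i',j)"
      then have "block_perm a b c i' = i" "i' < ?k" using block_perm_seq_index[OF Bc _ j, of i'] block_perm_bound[of i' a b c d] i(3)[of "block_perm a b c i'"] by simp_all
      then show "i' = block_perm a c b i" using block_perm_inverse[of i' a b c d] by simp
    qed
  qed
  have C: "B ;; (1\<^sub>m a \<oplus>\<^sub>m \<sigma>\<^sub>m b c \<oplus>\<^sub>m 1\<^sub>m d) \<in> carrier_mat ?k ?k"
    using Bc by (intro carrier_matI) (simp_all add: mat_seq_def)
  show ?thesis unfolding permutation_mat_def by (intro conjI allI impI C 1 2)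
qed

lemma is_harD:
  assumes "is_har \<Sigma> n m f"
  shows "har_mat f \<in> carrier_mat (har_size f) (har_size f)"
    "permutation_mat (har_size f) (har_left f)"
    "permutation_mat (har_size f) (har_right f)"
    "length (har_lab f) = har_size f"
    "acyclic (har_edges f)"
    "\<forall>(j, i) \<in> har_edges f. (har_lab f ! j = Bullet) \<noteq> (har_lab f ! i = Bullet)"
    "\<forall>v<har_size f. har_lab f ! v = Bullet \<longrightarrow> card {j. (j, v) \<in> har_edges f} \<le> 1 \<and> card {i. (v, i) \<in> har_edges f} \<le> 1"
    "card (left_nodes f) = n" "left_nodes f = {v. v < har_size f \<and> (\<exists>i<n. har_left f $$ (i, v))}"
    "card (right_nodes f) = m"
    "right_nodes f = {v. v < har_size f \<and> (\<exists>i. har_size f - m \<le> i \<and> i < har_size f \<and> har_right f $$ (i, v))}"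
    "\<forall>v<har_size f. \<forall>g. har_lab f ! v = Circ g \<longrightarrow> g \<in> ops \<Sigma> \<and>
            bij_betw (\<lambda>j. har_mat f $$ (v, j)) {j. (j, v) \<in> har_edges f} {1..arity \<Sigma> g} \<and>
            bij_betw (\<lambda>i. har_mat f $$ (i, v)) {i. (v, i) \<in> har_edges f} {1..coarity \<Sigma> g}"
  using assms unfolding is_har_def Let_def by - (elim conjE, assumption)+

lemma bij_betw_image_comp: "inj_on s A \<Longrightarrow> bij_betw f (s`A) B = bij_betw (f\<circ>s) A B"
  by (simp add: bij_betw_def comp_inj_on_iff image_comp)

lemma is_har_tensor:
  assumes f: "is_har \<Sigma> n1 m1 f" and g: "is_har \<Sigma> n2 m2 g"
  shows "is_har \<Sigma> (n1+n2) (m1+m2) (har_tensor n1 m1 n2 m2 f g)"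
proof -
  let ?k = "har_size f" and ?l = "har_size g"
  let ?t = "har_tensor n1 m1 n2 m2 f g"
  let ?s = "\<lambda>v. v + ?k"
  note Mf = is_harD(1)[OF f] and Mg = is_harD(1)[OF g]
  note Nf = is_harD(4)[OF f] and Ng = is_harD(4)[OF g]
  have [simp]: "har_size ?t = ?k + ?l" "har_lab ?t = har_lab f @ har_lab g" by (auto simp: har_tensor_def)
  have M: "har_mat ?t $$ (i,j) = (if i < ?k then if j < ?k then har_mat f $$ (i,j) else 0
     else if j < ?k then 0 else har_mat g $$ (i - ?k, j - ?k))" if "i < ?k+?l" "j < ?k+?l" for i j
    using that Mf Mg by (auto simp: har_tensor_def mat_dsum_index)
  have Mcar: "har_mat ?t \<in> carrier_mat (?k+?l) (?k+?l)" using Mf Mg by (intro carrier_matI) (simp_all add: har_tensor_def)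
  have E: "har_edges ?t = har_edges f \<union> map_prod ?s ?s ` har_edges g" (is "_ = _ \<union> ?G")
  proof (rule Set.set_eqI)
    fix e :: "nat \<times> nat" obtain j i where e: "e = (j,i)" by (cases e)
    have "e \<in> har_edges ?t \<longleftrightarrow> e \<in> har_edges f \<or> (?k \<le> j \<and> ?k \<le> i \<and> (j-?k,i-?k) \<in> har_edges g)"
      using M[of i j] unfolding e by (auto simp: har_edges_def split: if_splits)
    also have "(?k \<le> j \<and> ?k \<le> i \<and> (j-?k,i-?k) \<in> har_edges g) \<longleftrightarrow> e \<in> ?G"
    proof
      assume "?k \<le> j \<and> ?k \<le> i \<and> (j-?k,i-?k) \<in> har_edges g"
      then show "e \<in> ?G" unfolding e by (intro image_eqI[of _ _ "(j-?k,i-?k)"]) auto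
    qed (auto simp: e)
    finally show "e \<in> har_edges ?t \<longleftrightarrow> e \<in> har_edges f \<union> ?G" by auto
  qed
  have Ef: "i < ?k" "j < ?k" if "(j,i) \<in> har_edges f" for i j using that by (auto simp: har_edges_def)
  have inf: "{j. (j,v) \<in> har_edges ?t} = {j. (j,v) \<in> har_edges f}" if "v < ?k" for v
    using that by (auto simp: E)
  have outf: "{j. (v,j) \<in> har_edges ?t} = {j. (v,j) \<in> har_edges f}" if "v < ?k" for v
    using that by (auto simp: E)
  have ing: "{j. (j,v) \<in> har_edges ?t} = ?s ` {j. (j,v-?k) \<in> har_edges g}" if "v \<ge> ?k" for v
  proof (rule Set.set_eqI)
    fix j show "j \<in> {j. (j,v) \<in> har_edges ?t} \<longleftrightarrow> j \<in> ?s ` {j. (j,v-?k) \<in> har_edges g}"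
    proof
      assume "j \<in> ?s ` {j. (j,v-?k) \<in> har_edges g}"
      then obtain j' where j': "j = ?s j'" "(j',v-?k) \<in> har_edges g" by auto
      then show "j \<in> {j. (j,v) \<in> har_edges ?t}" unfolding E using that
        by simp (rule disjI2, rule image_eqI[of _ _ "(j',v-?k)"], auto)
    qed (use that in \<open>auto simp: E dest!: Ef(1)\<close>)
  qed
  have outg: "{j. (v,j) \<in> har_edges ?t} = ?s ` {j. (v-?k,j) \<in> har_edges g}" if "v \<ge> ?k" for v
  proof (rule Set.set_eqI)
    fix j show "j \<in> {j. (v,j) \<in> har_edges ?t} \<longleftrightarrow> j \<in> ?s ` {j. (v-?k,j) \<in> har_edges g}"
    proof
      assume "j \<in> ?s ` {j. (v-?k,j) \<in> har_edges g}"
      then obtain j' where j': "j = ?s j'" "(v-?k,j') \<in> har_edges g" by auto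
      then show "j \<in> {j. (v,j) \<in> har_edges ?t}" unfolding E using that
        by simp (rule disjI2, rule image_eqI[of _ _ "(v-?k,j')"], auto)
    qed (use that in \<open>auto simp: E dest!: Ef(2)\<close>)
  qed
  have split: "v < ?k \<or> (\<exists>w<?l. v = w + ?k)" if "v < ?k + ?l" for v
    proof (cases "v < ?k")
    case False then show ?thesis using that by (intro disjI2 exI[of _ "v-?k"]) auto
  qed simp
  have labf: "(har_lab f @ har_lab g) ! v = har_lab f ! v" if "v < ?k" for v using that Nf by (simp add: nth_append)
  have labg: "(har_lab f @ har_lab g) ! (v+?k) = har_lab g ! v" for v using Nf by (simp add: nth_append)
  have LN: "left_nodes ?t = left_nodes f \<union> ?s ` left_nodes g"
  proof (rule Set.set_eqI)
    fix v
    consider "v < ?k" | w where "w < ?l" "v = w + ?k" | "v \<ge> ?k+?l" using split[of v] by fastforce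
    then show "v \<in> left_nodes ?t \<longleftrightarrow> v \<in> left_nodes f \<union> ?s ` left_nodes g"
    proof cases
      case 1
      have X: "(\<forall>j. (j,v) \<notin> har_edges ?t) = (\<forall>j. (j,v) \<notin> har_edges f)" using inf[OF 1] by (simp add: set_eq_iff)
      show ?thesis using 1 X labf[OF 1] by (auto simp: left_nodes_def)
    next
      case 2
      then have "({j. (j,v) \<in> har_edges ?t} = {}) = ({j. (j,w) \<in> har_edges g} = {})" using ing[of v] by simp
      then have X: "(\<forall>j. (j,v) \<notin> har_edges ?t) = (\<forall>j. (j,w) \<notin> har_edges g)" by simp
      show ?thesis using X 2 labg[of w] by (auto simp: left_nodes_def)
    next
      case 3 then show ?thesis by (auto simp: left_nodes_def)
    qed
  qed
  have RN: "right_nodes ?t = right_nodes f \<union> ?s ` right_nodes g"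
  proof (rule Set.set_eqI)
    fix v
    consider "v < ?k" | w where "w < ?l" "v = w + ?k" | "v \<ge> ?k+?l" using split[of v] by fastforce
    then show "v \<in> right_nodes ?t \<longleftrightarrow> v \<in> right_nodes f \<union> ?s ` right_nodes g"
    proof cases
      case 1
      have X: "(\<forall>j. (v,j) \<notin> har_edges ?t) = (\<forall>j. (v,j) \<notin> har_edges f)" using outf[OF 1] by (simp add: set_eq_iff)
      show ?thesis using 1 X labf[OF 1] by (auto simp: right_nodes_def)
    next
      case 2
      then have "({j. (v,j) \<in> har_edges ?t} = {}) = ({j. (w,j) \<in> har_edges g} = {})" using outg[of v] by simp
      then have X: "(\<forall>j. (v,j) \<notin> har_edges ?t) = (\<forall>j. (w,j) \<notin> har_edges g)" by simp
      show ?thesis using X 2 labg[of w] by (auto simp: right_nodes_def)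
    next
      case 3 then show ?thesis by (auto simp: right_nodes_def)
    qed
  qed
  have sub: "left_nodes f \<subseteq> {..<?k}" "left_nodes g \<subseteq> {..<?l}" "right_nodes f \<subseteq> {..<?k}" "right_nodes g \<subseteq> {..<?l}"
    by (auto simp: left_nodes_def right_nodes_def)
  have cards: "card (left_nodes f) = n1" "card (left_nodes g) = n2" "card (right_nodes f) = m1" "card (right_nodes g) = m2"
    by (rule is_harD(8,10)[OF f] is_harD(8,10)[OF g])+
  have n: "n1 \<le> ?k" "n2 \<le> ?l" "m1 \<le> ?k" "m2 \<le> ?l"
    using card_mono[OF _ sub(1)] card_mono[OF _ sub(2)] card_mono[OF _ sub(3)] card_mono[OF _ sub(4)] cards by auto
  have fin: "finite (left_nodes f)" "finite (left_nodes g)" "finite (right_nodes f)" "finite (right_nodes g)"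
    using sub finite_subset by blast+
  have cL: "card (left_nodes ?t) = n1 + n2"
    unfolding LN using sub(1) fin cards by (subst card_Un_disjoint) (auto simp: card_image)
  have cR: "card (right_nodes ?t) = m1 + m2"
    unfolding RN using sub(3) fin cards by (subst card_Un_disjoint) (auto simp: card_image)
  have pL: "permutation_mat (?k+?l) (har_left f \<oplus>\<^sub>m har_left g)" and pR: "permutation_mat (?k+?l) (har_right f \<oplus>\<^sub>m har_right g)"
    by (rule permutation_mat_dsum is_harD(2,3)[OF f] is_harD(2,3)[OF g])+
  have kl1: "n1 + (?k-n1) + n2 + (?l-n2) = ?k+?l" and kl2: "(?k-m1) + m1 + (?l-m2) + m2 = ?k+?l" using n by auto
  have PL: "permutation_mat (?k+?l) (har_left ?t)" using permutation_mat_block_perm_seq[of n1 "?k-n1" n2 "?l-n2", unfolded kl1, OF pL]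
    by (simp add: har_tensor_def)
  have PR: "permutation_mat (?k+?l) (har_right ?t)" using permutation_mat_block_perm_seq[of "?k-m1" m1 "?l-m2" m2, unfolded kl2, OF pR]
    by (simp add: har_tensor_def)
  have dims: "dim_row (har_left f) = ?k" "dim_col (har_left f) = ?k" "dim_row (har_left g) = ?l" "dim_col (har_left g) = ?l"
    "dim_row (har_right f) = ?k" "dim_col (har_right f) = ?k" "dim_row (har_right g) = ?l" "dim_col (har_right g) = ?l"
    using is_harD(2,3)[OF f, THEN permutation_mat_carrier] is_harD(2,3)[OF g, THEN permutation_mat_carrier] by auto
  have L: "har_left ?t $$ (i,v) \<longleftrightarrow> (if i < n1 then v < ?k \<and> har_left f $$ (i,v) else v \<ge> ?k \<and> har_left g $$ (i-n1,v-?k))"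
    if "i < n1+n2" "v < ?k+?l" for i v
    using block_perm_seq_index[of _ n1 "?k-n1" n2 "?l-n2" i v, unfolded kl1, OF permutation_mat_carrier[OF pL]] that n dims
    by (auto simp: har_tensor_def block_perm_def mat_dsum_index zero_bool_def)
  have R: "har_right ?t $$ (i,v) \<longleftrightarrow> (if i < ?k+?l-m2 then v < ?k \<and> har_right f $$ (i-(?l-m2),v) else v \<ge> ?k \<and> har_right g $$ (i-?k,v-?k))"
    if "?k+?l-(m1+m2) \<le> i" "i < ?k+?l" "v < ?k+?l" for i v
  proof -
    have 1: "har_right ?t $$ (i,v) \<longleftrightarrow> (har_right f \<oplus>\<^sub>m har_right g) $$ (block_perm (?k-m1) m1 (?l-m2) i, v)"
      using block_perm_seq_index[of _ "?k-m1" m1 "?l-m2" m2 i v, unfolded kl2, OF permutation_mat_carrier[OF pR] that(2,3)] by (simp add: har_tensor_def)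
    have 2: "block_perm (?k-m1) m1 (?l-m2) i = (if i < ?k+?l-m2 then i-(?l-m2) else i)" using that n by (simp add: block_perm_def)
    show ?thesis
    proof (cases "i < ?k+?l-m2")
      case True
      then have "i - (?l-m2) < ?k" using n that by arith
      then show ?thesis using True that(3) dims unfolding 1 2 by (simp add: mat_dsum_index zero_bool_def)
    next
      case False
      then have "\<not> i < ?k" using n by arith
      then show ?thesis using False that(2,3) dims unfolding 1 2 by (auto simp add: mat_dsum_index zero_bool_def)
    qed
  qed
  have lf: "left_nodes f = {v. v < ?k \<and> (\<exists>i<n1. har_left f $$ (i, v))}" and lg: "left_nodes g = {v. v < ?l \<and> (\<exists>i<n2. har_left g $$ (i, v))}"
   and rf: "right_nodes f = {v. v < ?k \<and> (\<exists>i. ?k - m1 \<le> i \<and> i < ?k \<and> har_right f $$ (i, v))}"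
   and rg: "right_nodes g = {v. v < ?l \<and> (\<exists>i. ?l - m2 \<le> i \<and> i < ?l \<and> har_right g $$ (i, v))}"
    by (rule is_harD(9,11)[OF f] is_harD(9,11)[OF g])+
  have Lset: "left_nodes ?t = {v. v < ?k+?l \<and> (\<exists>i<n1+n2. har_left ?t $$ (i, v))}"
  proof (rule Set.set_eqI)
    fix v
    consider "v < ?k" | w where "w < ?l" "v = w + ?k" | "v \<ge> ?k+?l" using split[of v] by fastforce
    then show "v \<in> left_nodes ?t \<longleftrightarrow> v \<in> {v. v < ?k+?l \<and> (\<exists>i<n1+n2. har_left ?t $$ (i, v))}"
    proof cases
      case 1
      have "(\<exists>i<n1+n2. har_left ?t $$ (i, v)) \<longleftrightarrow> (\<exists>i<n1. har_left f $$ (i, v))"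
        using 1 L[of _ v] by (auto split: if_splits) (metis trans_less_add1)
      then show ?thesis using 1 by (auto simp: LN lf)
    next
      case 2
      have "(\<exists>i<n1+n2. har_left ?t $$ (i, v)) \<longleftrightarrow> (\<exists>i<n2. har_left g $$ (i, w))"
      proof
        assume "\<exists>i<n1+n2. har_left ?t $$ (i, v)"
        then obtain i where "i < n1+n2" "har_left ?t $$ (i,v)" by blast
        then show "\<exists>i<n2. har_left g $$ (i, w)" using 2 L[of i v] by (intro exI[of _ "i-n1"]) (auto split: if_splits)
      next
        assume "\<exists>i<n2. har_left g $$ (i, w)"
        then obtain i where "i < n2" "har_left g $$ (i,w)" by blast
        then show "\<exists>i<n1+n2. har_left ?t $$ (i, v)" using 2 L[of "i+n1" v] by (intro exI[of _ "i+n1"]) (auto split: if_splits)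
      qed
      then show ?thesis using 2 sub(1) by (auto simp: LN lg)
    next
      case 3 then show ?thesis by (auto simp: left_nodes_def)
    qed
  qed
  have Rset: "right_nodes ?t = {v. v < ?k+?l \<and> (\<exists>i. ?k+?l-(m1+m2) \<le> i \<and> i < ?k+?l \<and> har_right ?t $$ (i, v))}"
  proof (rule Set.set_eqI)
    fix v
    consider "v < ?k" | w where "w < ?l" "v = w + ?k" | "v \<ge> ?k+?l" using split[of v] by fastforce
    then show "v \<in> right_nodes ?t \<longleftrightarrow> v \<in> {v. v < ?k+?l \<and> (\<exists>i. ?k+?l-(m1+m2) \<le> i \<and> i < ?k+?l \<and> har_right ?t $$ (i, v))}"
    proof cases
      case 1
      have "(\<exists>i. ?k+?l-(m1+m2) \<le> i \<and> i < ?k+?l \<and> har_right ?t $$ (i, v)) \<longleftrightarrow> (\<exists>i. ?k - m1 \<le> i \<and> i < ?k \<and> har_right f $$ (i, v))" (is "?A \<longleftrightarrow> ?B")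
      proof
        assume ?A
        then obtain i where "?k+?l-(m1+m2) \<le> i" "i < ?k+?l" "har_right ?t $$ (i,v)" by blast
        then show ?B using 1 n R[of i v] by (intro exI[of _ "i-(?l-m2)"]) (auto split: if_splits)
      next
        assume ?B
        then obtain i where "?k - m1 \<le> i" "i < ?k" "har_right f $$ (i,v)" by blast
        then show ?A using 1 n R[of "i+(?l-m2)" v] by (intro exI[of _ "i+(?l-m2)"]) (auto split: if_splits)
      qed
      then show ?thesis using 1 by (auto simp: RN rf)
    next
      case 2
      have "(\<exists>i. ?k+?l-(m1+m2) \<le> i \<and> i < ?k+?l \<and> har_right ?t $$ (i, v)) \<longleftrightarrow> (\<exists>i. ?l - m2 \<le> i \<and> i < ?l \<and> har_right g $$ (i, w))" (is "?A \<longleftrightarrow> ?B")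
      proof
        assume ?A
        then obtain i where "?k+?l-(m1+m2) \<le> i" "i < ?k+?l" "har_right ?t $$ (i,v)" by blast
        then show ?B using 2 n R[of i v] by (intro exI[of _ "i-?k"]) (auto split: if_splits)
      next
        assume ?B
        then obtain i where "?l - m2 \<le> i" "i < ?l" "har_right g $$ (i,w)" by blast
        then show ?A using 2 n R[of "i+?k" v] by (intro exI[of _ "i+?k"]) (auto split: if_splits)
      qed
      then show ?thesis using 2 sub(3) by (auto simp: RN rg)
    next
      case 3 then show ?thesis by (auto simp: right_nodes_def)
    qed
  qed
  have og: "?k \<le> y \<and> (x-?k,y-?k) \<in> har_edges g" if "(x,y) \<in> har_edges ?t" "?k \<le> x" for x y
    using that unfolding E by (auto dest!: Ef(2))
  have acyc: "acyclic (har_edges ?t)"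
  proof (rule acyclicI, rule allI)
    fix x
    have A: "y < ?k \<and> (x,y) \<in> (har_edges f)\<^sup>+" if "(x,y) \<in> (har_edges ?t)\<^sup>+" "x < ?k" for x y
      using that
    proof (induction rule: trancl_induct)
      case (base y) then have "(x,y) \<in> har_edges f" using outf by blast
      then show ?case using Ef by auto
    next
      case (step y z) then have "(y,z) \<in> har_edges f" using outf by blast
      then show ?case using Ef step by (auto intro: trancl_into_trancl)
    qed
    have B: "?k \<le> y \<and> (x-?k,y-?k) \<in> (har_edges g)\<^sup>+" if "(x,y) \<in> (har_edges ?t)\<^sup>+" "?k \<le> x" for x y
      using that
    proof (induction rule: trancl_induct)
      case (base y) then have "?k \<le> y \<and> (x-?k,y-?k) \<in> har_edges g" using og by blast
      then show ?case by auto
    next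
      case (step y z) then have "?k \<le> z \<and> (y-?k,z-?k) \<in> har_edges g" using og by blast
      then show ?case using step by (auto intro: trancl_into_trancl)
    qed
    have "acyclic (har_edges f)" "acyclic (har_edges g)" by (rule is_harD(5)[OF f] is_harD(5)[OF g])+
    then show "(x, x) \<notin> (har_edges ?t)\<^sup>+" using A[of x x] B[of x x] by (cases "x < ?k") (auto simp: acyclic_def)
  qed
  have bip: "\<forall>(j, i) \<in> har_edges ?t. (har_lab ?t ! j = Bullet) \<noteq> (har_lab ?t ! i = Bullet)"
  proof -
    have "(har_lab ?t ! j = Bullet) \<noteq> (har_lab ?t ! i = Bullet)" if e: "(j,i) \<in> har_edges ?t" for j i
    proof -
      consider "(j,i) \<in> har_edges f" | j' i' where "(j',i') \<in> har_edges g" "j = j'+?k" "i = i'+?k"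
        using e unfolding E by auto
      then show ?thesis
      proof cases
        case 1
        then have "(har_lab f ! j = Bullet) \<noteq> (har_lab f ! i = Bullet)" using is_harD(6)[OF f] by blast
        then show ?thesis using labf[OF Ef(1)[OF 1]] labf[OF Ef(2)[OF 1]] by simp
      next
        case 2
        then have "(har_lab g ! j' = Bullet) \<noteq> (har_lab g ! i' = Bullet)" using is_harD(6)[OF g] by blast
        then show ?thesis unfolding 2(2,3) using labg[of j'] labg[of i'] by simp
      qed
    qed
    then show ?thesis by blast
  qed
  have deg: "\<forall>v<?k+?l. har_lab ?t ! v = Bullet \<longrightarrow> card {j. (j, v) \<in> har_edges ?t} \<le> 1 \<and> card {i. (v, i) \<in> har_edges ?t} \<le> 1"
  proof (intro allI impI)
    fix v assume v: "v < ?k+?l" "har_lab ?t ! v = Bullet"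
    from split[OF v(1)] show "card {j. (j, v) \<in> har_edges ?t} \<le> 1 \<and> card {i. (v, i) \<in> har_edges ?t} \<le> 1"
    proof (elim disjE exE conjE)
      assume a: "v < ?k" then show ?thesis unfolding inf[OF a] outf[OF a] using is_harD(7)[OF f, rule_format, OF a] v(2) labf[OF a] by simp
    next
      fix w assume a: "w < ?l" "v = w + ?k"
      then have "card {j. (j, w) \<in> har_edges g} \<le> 1 \<and> card {i. (w, i) \<in> har_edges g} \<le> 1" using is_harD(7)[OF g, rule_format, OF a(1)] v(2) labg[of w] by simp
      then show ?thesis using ing[of v] outg[of v] a(2) by (simp add: card_image)
    qed
  qed
  have circ: "h \<in> ops \<Sigma> \<and>
            bij_betw (\<lambda>j. har_mat ?t $$ (v, j)) {j. (j, v) \<in> har_edges ?t} {1..arity \<Sigma> h} \<and>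
            bij_betw (\<lambda>i. har_mat ?t $$ (i, v)) {i. (v, i) \<in> har_edges ?t} {1..coarity \<Sigma> h}" (is "?C1 \<and> ?C2 \<and> ?C3")
    if v: "v < ?k+?l" "har_lab ?t ! v = Circ h" for v h
    using split[OF v(1)]
  proof (elim disjE exE conjE)
    assume a: "v < ?k"
    then have H: "h \<in> ops \<Sigma> \<and> bij_betw (\<lambda>j. har_mat f $$ (v, j)) {j. (j, v) \<in> har_edges f} {1..arity \<Sigma> h} \<and>
            bij_betw (\<lambda>i. har_mat f $$ (i, v)) {i. (v, i) \<in> har_edges f} {1..coarity \<Sigma> h}" using is_harD(12)[OF f, rule_format, OF a] v(2) labf[OF a] by simp
    have "?C2 = bij_betw (\<lambda>j. har_mat f $$ (v, j)) {j. (j, v) \<in> har_edges f} {1..arity \<Sigma> h}"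
      unfolding inf[OF a] using a M by (intro bij_betw_cong) (auto dest!: Ef(2))
    moreover have "?C3 = bij_betw (\<lambda>i. har_mat f $$ (i, v)) {i. (v, i) \<in> har_edges f} {1..coarity \<Sigma> h}"
      unfolding outf[OF a] using a M by (intro bij_betw_cong) (auto dest!: Ef(1))
    ultimately show ?thesis using H by simp
  next
    fix w assume a: "w < ?l" "v = w + ?k"
    then have H: "h \<in> ops \<Sigma> \<and> bij_betw (\<lambda>j. har_mat g $$ (w, j)) {j. (j, w) \<in> har_edges g} {1..arity \<Sigma> h} \<and>
            bij_betw (\<lambda>i. har_mat g $$ (i, w)) {i. (w, i) \<in> har_edges g} {1..coarity \<Sigma> h}" using is_harD(12)[OF g, rule_format, OF a(1)] v(2) labg[of w] a(2) by simp
    have vk: "?k \<le> v" "v - ?k = w" using a by auto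
    have Eg: "i < ?l" "j < ?l" if "(j,i) \<in> har_edges g" for i j using that by (auto simp: har_edges_def)
    have inj: "inj_on ?s X" for X by auto
    have "?C2 = bij_betw ((\<lambda>j. har_mat ?t $$ (v, j)) \<circ> ?s) {j. (j, w) \<in> har_edges g} {1..arity \<Sigma> h}"
      unfolding ing[OF vk(1)] vk(2) by (rule bij_betw_image_comp) simp
    also have "\<dots> = bij_betw (\<lambda>j. har_mat g $$ (w, j)) {j. (j, w) \<in> har_edges g} {1..arity \<Sigma> h}"
      using a M by (intro bij_betw_cong) (auto dest!: Eg(2))
    finally have 1: "?C2 = \<dots>" .
    have "?C3 = bij_betw ((\<lambda>j. har_mat ?t $$ (j, v)) \<circ> ?s) {j. (w, j) \<in> har_edges g} {1..coarity \<Sigma> h}"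
      unfolding outg[OF vk(1)] vk(2) by (rule bij_betw_image_comp) simp
    also have "\<dots> = bij_betw (\<lambda>j. har_mat g $$ (j, w)) {j. (w, j) \<in> har_edges g} {1..coarity \<Sigma> h}"
      using a M by (intro bij_betw_cong) (auto dest!: Eg(1))
    finally have 2: "?C3 = \<dots>" .
    show ?thesis using 1 2 H by simp
  qed
  show ?thesis
    unfolding is_har_def Let_def
    using Mcar PL PR Nf Ng acyc bip deg circ cL cR Lset Rset by simp
qed


section \<open>Unit-cost RAM\<close>

text \<open>
  Registers and memory cells hold natural numbers; subtraction is truncated. Every executed
  instruction costs one time unit, and the machine has halted once the program counter is outside
  the program. There is no multiplication: repeated unit-cost multiplication would build very
  long numbers quickly.
\<close>

datatype instr =
    Const nat nat
  | Move nat nat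
  | Add nat nat nat
  | Sub nat nat nat
  | Load nat nat
  | Store nat nat
  | Jump nat
  | JumpZero nat nat

record ram_state =
  pc :: nat
  reg :: "nat \<Rightarrow> nat"
  mem :: "nat \<Rightarrow> nat"

definition goto :: "nat \<Rightarrow> ram_state \<Rightarrow> ram_state" where
  "goto l s = s\<lparr>pc := l\<rparr>"

definition set_reg :: "nat \<Rightarrow> nat \<Rightarrow> ram_state \<Rightarrow> ram_state" where
  "set_reg r x s = s\<lparr>reg := (reg s)(r := x), pc := Suc (pc s)\<rparr>"

fun exec_instr :: "instr \<Rightarrow> ram_state \<Rightarrow> ram_state" where
  "exec_instr (Const r x) s = set_reg r x s"
| "exec_instr (Move r a) s = set_reg r (reg s a) s"
| "exec_instr (Add r a b) s = set_reg r (reg s a + reg s b) s"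
| "exec_instr (Sub r a b) s = set_reg r (reg s a - reg s b) s"
| "exec_instr (Load r a) s = set_reg r (mem s (reg s a)) s"
| "exec_instr (Store a r) s = s\<lparr>mem := (mem s)(reg s a := reg s r), pc := Suc (pc s)\<rparr>"
| "exec_instr (Jump l) s = goto l s"
| "exec_instr (JumpZero r l) s = goto (if reg s r = 0 then l else Suc (pc s)) s"

definition halted :: "instr list \<Rightarrow> ram_state \<Rightarrow> bool" where
  "halted p s \<longleftrightarrow> length p \<le> pc s"

definition step :: "instr list \<Rightarrow> ram_state \<Rightarrow> ram_state" where
  "step p s = (if halted p s then s else exec_instr (p ! pc s) s)"

definition halts_within :: "instr list \<Rightarrow> ram_state \<Rightarrow> nat \<Rightarrow> ram_state \<Rightarrow> bool" where
  "halts_within p s T s' \<longleftrightarrow> (\<exists>t\<le>T. (step p ^^ t) s = s') \<and> halted p s'"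


section \<open>Memory representation\<close>

text \<open>
  In all predicates below, \<open>h\<close> is the memory contents, and \<open>b\<close> an upper bound: the data
  structure only uses cells below \<open>b\<close>. A list of numbers is stored in consecutive cells.
\<close>

definition array_at :: "(nat \<Rightarrow> nat) \<Rightarrow> nat \<Rightarrow> nat \<Rightarrow> nat list \<Rightarrow> bool" where
  "array_at h b a xs \<longleftrightarrow> a + length xs \<le> b \<and> (\<forall>i<length xs. h (a + i) = xs ! i)"

text \<open>
  Row \<open>i\<close> is stored as the number of its non-zero entries, followed by the pairs of column index
  and value, in any order.
\<close>

definition row_at :: "(nat \<Rightarrow> nat) \<Rightarrow> nat \<Rightarrow> nat \<Rightarrow> nat mat \<Rightarrow> nat \<Rightarrow> bool" where
  "row_at h b a A i \<longleftrightarrow>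
     (\<exists>es. distinct es \<and>
        set es = {(j, A $$ (i, j)) | j. j < dim_col A \<and> A $$ (i, j) \<noteq> 0} \<and>
        array_at h b a (length es # concat (map (\<lambda>(j, x). [j, x]) es)))"

definition sparse_mat_at :: "(nat \<Rightarrow> nat) \<Rightarrow> nat \<Rightarrow> nat \<Rightarrow> nat mat \<Rightarrow> bool" where
  "sparse_mat_at h b a A \<longleftrightarrow>
     (\<exists>rows. length rows = dim_row A \<and> array_at h b a rows \<and>
        (\<forall>i<dim_row A. row_at h b (rows ! i) A i))"

fun node_code :: "('o \<Rightarrow> nat) \<Rightarrow> 'o node \<Rightarrow> nat" where
  "node_code code Bullet = 0"
| "node_code code (Circ g) = Suc (code g)"

text \<open>
  A HAR of type \<open>n \<rightarrow> m\<close> is stored as a header holding its size, its type, and pointers to its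
  matrices and its label array; \<open>code\<close> is the numbering of the operations used for the labels.
\<close>

definition har_at ::
  "('o \<Rightarrow> nat) \<Rightarrow> (nat \<Rightarrow> nat) \<Rightarrow> nat \<Rightarrow> nat \<Rightarrow> nat \<Rightarrow> nat \<Rightarrow> 'o har \<Rightarrow> bool" where
  "har_at code h b a n m f \<longleftrightarrow>
     (\<exists>aM aL aR aN. array_at h b a [har_size f, n, m, aM, aL, aR, aN] \<and>
        sparse_mat_at h b aM (har_mat f) \<and>
        sparse_mat_at h b aL (bool_to_nat_mat (har_left f)) \<and>
        sparse_mat_at h b aR (bool_to_nat_mat (har_right f)) \<and>
        array_at h b aN (map (node_code code) (har_lab f)))"

text \<open>
  Calling convention for tensor products: registers 0 and 1 point to the headers of \<open>f\<close> and \<open>g\<close>,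
  register 2 to the beginning of the free memory. All other registers and the free
  memory have arbitrary contents.
\<close>

definition tensor_input ::
  "('o \<Rightarrow> nat) \<Rightarrow> nat \<Rightarrow> nat \<Rightarrow> nat \<Rightarrow> nat \<Rightarrow> 'o har \<Rightarrow> 'o har \<Rightarrow> ram_state \<Rightarrow> bool" where
  "tensor_input code n1 m1 n2 m2 f g s \<longleftrightarrow> pc s = 0 \<and>
     har_at code (mem s) (reg s 2) (reg s 0) n1 m1 f \<and>
     har_at code (mem s) (reg s 2) (reg s 1) n2 m2 g"

text \<open>On output, register 0 points to the header of the result.\<close>

definition har_output :: "('o \<Rightarrow> nat) \<Rightarrow> nat \<Rightarrow> nat \<Rightarrow> 'o har \<Rightarrow> ram_state \<Rightarrow> bool" where
  "har_output code n m f s \<longleftrightarrow> (\<exists>b. har_at code (mem s) b (reg s 0) n m f)"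

end

theory Submission
  imports Defs
begin

text \<open>
  Each of the three matrices of \<open>f \<otimes> g\<close> consists of the rows of \<open>f\<close>, unchanged, and of the rows of \<open>g\<close> with
  their column indices increased by the size of \<open>f\<close>; the permutations only change the order of the rows to
  \<open>f[0..a)\<close>, \<open>g[0..c)\<close>, \<open>f[a..)\<close>, \<open>g[c..)\<close>, where \<open>(a, c)\<close> is the pair of sizes for the adjacency matrix,
  \<open>(n1, n2)\<close> for the left and the sizes minus \<open>(m1, m2)\<close> for the right permutation. It therefore suffices
  to copy the shifted rows of \<open>g\<close> into fresh memory and to arrange pointers, those to the rows of \<open>f\<close> being shared.
  A row of the adjacency matrix has at most one entry for a \<open>\<bullet>\<close>-vertex and as many entries as the arity for
  an operation, and a row of a permutation matrix has one entry, so the cost per row depends only on \<open>\<Sigma>\<close>.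
\<close>

section \<open>Structured programs\<close>

datatype com =
    Block "instr list"
  | Seq com com  (infixr \<open>\<Zsemi>\<close> 60)
  | While nat com

fun com_length :: "com \<Rightarrow> nat" where
  "com_length (Block is) = length is"
| "com_length (c \<Zsemi> d) = com_length c + com_length d"
| "com_length (While r c) = com_length c + 2"

text \<open>Jump targets are absolute, so the code depends on its start address \<open>k\<close>.\<close>

fun compile :: "nat \<Rightarrow> com \<Rightarrow> instr list" where
  "compile k (Block is) = is"
| "compile k (c \<Zsemi> d) = compile k c @ compile (k + com_length c) d"
| "compile k (While r c) = JumpZero r (k + com_length c + 2) # compile (Suc k) c @ [Jump k]"

lemma length_compile [simp]: "length (compile k c) = com_length c"
  by (induction c arbitrary: k) auto

section \<open>Cost semantics on stores\<close>

type_synonym store = "(nat \<Rightarrow> nat) \<times> (nat \<Rightarrow> nat)"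

definition at_pc :: "nat \<Rightarrow> store \<Rightarrow> ram_state" where
  "at_pc k s = \<lparr>pc = k, reg = fst s, mem = snd s\<rparr>"

lemma at_pc_simps [simp]: "pc (at_pc k s) = k" "reg (at_pc k s) = fst s" "mem (at_pc k s) = snd s"
  by (simp_all add: at_pc_def)

fun is_jump :: "instr \<Rightarrow> bool" where
  "is_jump (Jump l) = True"
| "is_jump (JumpZero r l) = True"
| "is_jump _ = False"

text \<open>The program counter 0 is a dummy: the registers and memory after an instruction do not
  depend on it.\<close>

definition exec_store :: "instr \<Rightarrow> store \<Rightarrow> store" where
  "exec_store i s = (let s' = exec_instr i (at_pc 0 s) in (reg s', mem s'))"

lemma exec_store_simps [simp]:
  "exec_store (Const r x) (R, h) = (R(r := x), h)"
  "exec_store (Move r a) (R, h) = (R(r := R a), h)"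
  "exec_store (Add r a b) (R, h) = (R(r := R a + R b), h)"
  "exec_store (Sub r a b) (R, h) = (R(r := R a - R b), h)"
  "exec_store (Load r a) (R, h) = (R(r := h (R a)), h)"
  "exec_store (Store a r) (R, h) = (R, h(R a := R r))"
  by (simp_all add: exec_store_def set_reg_def)

lemma exec_instr_at_pc:
  "\<not> is_jump i \<Longrightarrow> exec_instr i (at_pc k s) = at_pc (Suc k) (exec_store i s)"
  by (cases i) (simp_all add: exec_store_def set_reg_def at_pc_def)

text \<open>The time is the exact number of executed instructions: a failing loop test costs 1, a
  full round costs 2 on top of its body, for the test and the jump back. Blocks are straight-line
  code, so all control flow comes from \<open>While\<close>.\<close>

inductive run :: "com \<Rightarrow> store \<Rightarrow> nat \<Rightarrow> store \<Rightarrow> bool" where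
  run_Block: "list_all (\<lambda>i. \<not> is_jump i) is \<Longrightarrow> run (Block is) s (length is) (fold exec_store is s)"
| run_Seq: "run c s t s' \<Longrightarrow> run d s' u s'' \<Longrightarrow> run (c \<Zsemi> d) s (t + u) s''"
| run_While_zero: "fst s r = 0 \<Longrightarrow> run (While r c) s 1 s"
| run_While_nonzero: "fst s r \<noteq> 0 \<Longrightarrow> run c s t s' \<Longrightarrow> run (While r c) s' u s'' \<Longrightarrow>
    run (While r c) s (t + u + 2) s''"

text \<open>The \<open>_eq\<close> variants have plain variables for time and final store in their
  conclusions, so that they apply to any goal and leave the equations to be proved.\<close>

lemma run_Block_eq:
  "list_all (\<lambda>i. \<not> is_jump i) is \<Longrightarrow> t = length is \<Longrightarrow> fold exec_store is s = s' \<Longrightarrow> run (Block is) s t s'"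
  using run_Block by blast

lemma run_Seq_eq: "run c s t s' \<Longrightarrow> run d s' u s'' \<Longrightarrow> v = t + u \<Longrightarrow> run (c \<Zsemi> d) s v s''"
  using run_Seq by blast

lemma run_While_zero_eq: "fst s r = 0 \<Longrightarrow> t = 1 \<Longrightarrow> s' = s \<Longrightarrow> run (While r c) s t s'"
  using run_While_zero by blast

lemma run_While_nonzero_eq:
  "fst s r \<noteq> 0 \<Longrightarrow> run c s t s' \<Longrightarrow> run (While r c) s' u s'' \<Longrightarrow> v = t + u + 2 \<Longrightarrow>
    run (While r c) s v s''"
  using run_While_nonzero by blast

section \<open>Correctness of compilation\<close>

definition code_at :: "instr list \<Rightarrow> nat \<Rightarrow> instr list \<Rightarrow> bool" where
  "code_at p k xs \<longleftrightarrow> k + length xs \<le> length p \<and> (\<forall>i<length xs. p ! (k + i) = xs ! i)"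

lemma code_at_Cons: "code_at p k (x # xs) \<longleftrightarrow> k < length p \<and> p ! k = x \<and> code_at p (Suc k) xs"
  by (auto simp: code_at_def All_less_Suc2)

lemma code_at_append:
  "code_at p k (xs @ ys) \<longleftrightarrow> code_at p k xs \<and> code_at p (k + length xs) ys"
proof (induction xs arbitrary: k)
  case Nil then show ?case by (auto simp: code_at_def)
qed (auto simp: code_at_Cons)

lemma step_at_pc: "k < length p \<Longrightarrow> step p (at_pc k s) = exec_instr (p ! k) (at_pc k s)"
  by (simp add: step_def halted_def)

lemma steps_block:
  "list_all (\<lambda>i. \<not> is_jump i) is \<Longrightarrow> code_at p k is \<Longrightarrow>
    (step p ^^ length is) (at_pc k s) = at_pc (k + length is) (fold exec_store is s)"
  by (induction "is" arbitrary: k s)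
    (simp_all add: code_at_Cons step_at_pc exec_instr_at_pc funpow_Suc_right del: funpow.simps)

text \<open>The surrounding program \<open>p\<close> is arbitrary and the start address is
  generalized, because in the induction the code of a subcommand is only a fragment of the
  whole.\<close>

lemma run_compile:
  "run c s t s' \<Longrightarrow> code_at p k (compile k c) \<Longrightarrow>
    (step p ^^ t) (at_pc k s) = at_pc (k + com_length c) s'"
proof (induction arbitrary: k rule: run.induct)
  case (run_Block "is" s)
  then show ?case by (simp add: steps_block)
next
  case (run_Seq c s t s' d u s'')
  then show ?case by (simp add: code_at_append add.commute[of t] funpow_add add.assoc)
next
  case (run_While_zero s r c)
  then show ?case using step_at_pc[of k p s] by (simp add: code_at_Cons goto_def at_pc_def)
next
  case (run_While_nonzero s r c t s' u s'')
  have code: "k < length p" "p ! k = JumpZero r (k + com_length c + 2)"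
    "code_at p (Suc k) (compile (Suc k) c)"
    "Suc k + com_length c < length p" "p ! (Suc k + com_length c) = Jump k"
    using run_While_nonzero.prems by (simp_all add: code_at_Cons code_at_append)
  have 1: "step p (at_pc k s) = at_pc (Suc k) s"
    using code run_While_nonzero.hyps step_at_pc[of k p s] by (simp add: goto_def at_pc_def)
  have 2: "step p (at_pc (Suc k + com_length c) s') = at_pc k s'"
    using code step_at_pc[of "Suc k + com_length c" p s'] by (simp add: goto_def at_pc_def)
  \<comment> \<open>\<open>funpow_add\<close> executes the right summand first, so the sum reads
    from right to left: test, body, jump back, remaining rounds.\<close>
  have "(step p ^^ (t + u + 2)) (at_pc k s) = (step p ^^ (u + (1 + (t + 1)))) (at_pc k s)"
    by (simp add: ac_simps)
  also have "\<dots> = at_pc (k + com_length (While r c)) s''"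
    unfolding funpow_add using 1 2 run_While_nonzero.IH(1)[OF code(3)]
      run_While_nonzero.IH(2)[OF run_While_nonzero.prems] by simp
  finally show ?case .
qed

lemma halts_within_compile:
  assumes "run c (reg s, mem s) t (R, h)" "pc s = 0" "t \<le> T"
  shows "halts_within (compile 0 c) s T (at_pc (com_length c) (R, h))"
proof -
  have "code_at (compile 0 c) 0 (compile 0 c)" by (simp add: code_at_def)
  moreover have "at_pc 0 (reg s, mem s) = s" using assms(2) by (simp add: at_pc_def)
  ultimately have "(step (compile 0 c) ^^ t) s = at_pc (com_length c) (R, h)"
    using run_compile[OF assms(1), of "compile 0 c" 0] by simp
  then show ?thesis using assms(3) by (auto simp: halts_within_def halted_def)
qed


section \<open>Arrays in memory\<close>

text \<open>A closed form instead of iterated updates, so that reads are settled by comparing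
  addresses; \<open>write_list_Cons\<close> gives back the view of a loop that stores one cell per
  round.\<close>

definition write_list :: "(nat \<Rightarrow> nat) \<Rightarrow> nat \<Rightarrow> nat list \<Rightarrow> nat \<Rightarrow> nat" where
  "write_list h d xs = (\<lambda>x. if d \<le> x \<and> x < d + length xs then xs ! (x - d) else h x)"

lemma write_list_Nil [simp]: "write_list h d [] = h"
  by (auto simp: write_list_def)

lemma write_list_Cons: "write_list h d (x # xs) = write_list (h(d := x)) (Suc d) xs"
  by (auto simp: write_list_def fun_eq_iff nth_Cons' Suc_diff_le)

lemma write_list_append:
  "write_list h d (xs @ ys) = write_list (write_list h d xs) (d + length xs) ys"
  by (induction xs arbitrary: h d) (simp_all add: write_list_Cons)

lemma write_list_below: "x < d \<Longrightarrow> write_list h d xs x = h x"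
  by (simp add: write_list_def)

lemma array_at_write_list: "array_at (write_list h d xs) (d + length xs) d xs"
  by (simp add: array_at_def write_list_def)

lemma array_at_Cons: "array_at h b a (x # xs) \<longleftrightarrow> a < b \<and> h a = x \<and> array_at h b (Suc a) xs"
  by (auto simp: array_at_def All_less_Suc2)

lemma array_at_append:
  "array_at h b a (xs @ ys) \<longleftrightarrow> array_at h b a xs \<and> array_at h b (a + length xs) ys"
proof (induction xs arbitrary: a)
  case Nil then show ?case by (auto simp: array_at_def)
qed (auto simp: array_at_Cons)

text \<open>The frame rule: data below \<open>b\<close> survives any change of the memory at or
  above \<open>b\<close>.\<close>

lemma array_at_mono:
  "array_at h b a xs \<Longrightarrow> b \<le> b' \<Longrightarrow> (\<And>x. x < b \<Longrightarrow> h' x = h x) \<Longrightarrow> array_at h' b' a xs"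
  by (auto simp: array_at_def)


text \<open>In all programs below, register 3 holds 1, register 2 the next free address, and register 5 a loop counter.\<close>

definition copy :: "nat \<Rightarrow> com" where
  "copy r = While 5 (Block [Load 4 r, Store 2 4, Add r r 3, Add 2 2 3, Sub 5 5 3])"

text \<open>The source lies below the write address \<open>R 2\<close>, so the growing copy never
  overwrites it. A round takes five instructions and two for loop control. The last value of the
  scratch register 4 is left open.\<close>

lemma run_copy:
  assumes "array_at h (R 2) (R r) xs" "length xs = R 5" "R 3 = 1" "5 < r"
  shows "\<exists>t. run (copy r) (R, h) (7 * length xs + 1)
    (R(4 := t, 5 := 0, r := R r + length xs, 2 := R 2 + length xs), write_list h (R 2) xs)"
  using assms
proof (induction xs arbitrary: R h)
  case Nil
  then have "R(4 := R 4, 5 := 0, r := R r + length [], 2 := R 2 + length []) = R" by auto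
  then have "run (copy r) (R, h) (7 * length [] + 1)
    (R(4 := R 4, 5 := 0, r := R r + length [], 2 := R 2 + length []), write_list h (R 2) [])"
    unfolding copy_def using Nil by (auto intro!: run_While_zero_eq)
  then show ?case by blast
next
  case (Cons x xs)
  let ?R = "R(4 := x, r := Suc (R r), 2 := Suc (R 2), 5 := R 5 - 1)" and ?h = "h(R 2 := x)"
  have x: "h (R r) = x" and xs: "array_at h (R 2) (Suc (R r)) xs"
    using Cons.prems by (simp_all add: array_at_Cons)
  have body: "run (Block [Load 4 r, Store 2 4, Add r r 3, Add 2 2 3, Sub 5 5 3]) (R, h) 5 (?R, ?h)"
    using Cons.prems x by (intro run_Block_eq) auto
  have "array_at ?h (?R 2) (?R r) xs" "length xs = ?R 5" "?R 3 = 1"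
    using Cons.prems by (auto intro: array_at_mono[OF xs])
  from Cons.IH[OF this \<open>5 < r\<close>] obtain t where "run (copy r) (?R, ?h) (7 * length xs + 1)
    (?R(4 := t, 5 := 0, r := ?R r + length xs, 2 := ?R 2 + length xs), write_list ?h (?R 2) xs)"
    by blast
  moreover have "?R(4 := t, 5 := 0, r := ?R r + length xs, 2 := ?R 2 + length xs) =
      R(4 := t, 5 := 0, r := R r + length (x # xs), 2 := R 2 + length (x # xs))"
    using Cons.prems by auto
  moreover have "write_list ?h (?R 2) xs = write_list h (R 2) (x # xs)"
    using Cons.prems by (simp add: write_list_Cons)
  ultimately have "run (copy r) (?R, ?h) (7 * length xs + 1)
    (R(4 := t, 5 := 0, r := R r + length (x # xs), 2 := R 2 + length (x # xs)),
     write_list h (R 2) (x # xs))" by metis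
  then have "run (copy r) (R, h) (7 * length (x # xs) + 1)
    (R(4 := t, 5 := 0, r := R r + length (x # xs), 2 := R 2 + length (x # xs)),
     write_list h (R 2) (x # xs))"
    unfolding copy_def using body Cons.prems by (elim run_While_nonzero_eq[rotated 2]) auto
  then show ?case by blast
qed


section \<open>Sparse rows\<close>

type_synonym row = "(nat \<times> nat) list"

definition pairs :: "row \<Rightarrow> nat list" where
  "pairs es = concat (map (\<lambda>(j, x). [j, x]) es)"

definition shift :: "nat \<Rightarrow> row \<Rightarrow> row" where
  "shift k es = map (\<lambda>(j, x). (j + k, x)) es"

lemma pairs_simps [simp]: "pairs [] = []" "pairs ((j, x) # es) = j # x # pairs es"
  by (simp_all add: pairs_def)

lemma shift_simps [simp]: "shift k [] = []" "shift k ((j, x) # es) = (j + k, x) # shift k es"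
  by (simp_all add: shift_def)

lemma length_shift [simp]: "length (shift k es) = length es"
  by (simp add: shift_def)

lemma length_pairs [simp]: "length (pairs es) = 2 * length es"
  by (induction es) auto

text \<open>No matrix occurs here: programs only see rows in storage order. The rows need not be
  disjoint from other data, which allows the result to share the rows of \<open>f\<close>.\<close>

definition rows_at :: "(nat \<Rightarrow> nat) \<Rightarrow> nat \<Rightarrow> nat \<Rightarrow> row list \<Rightarrow> bool" where
  "rows_at h b a ess \<longleftrightarrow> (\<exists>ps. array_at h b a ps \<and>
     list_all2 (\<lambda>p es. array_at h b p (length es # pairs es)) ps ess)"

lemma rows_at_Nil: "rows_at h b a [] \<longleftrightarrow> a \<le> b"
  by (simp add: rows_at_def array_at_def)

lemma rows_at_Cons: "rows_at h b a (es # ess) \<longleftrightarrow>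
    a < b \<and> array_at h b (h a) (length es # pairs es) \<and> rows_at h b (Suc a) ess"
  (is "?l \<longleftrightarrow> ?r")
proof
  assume ?l
  then show ?r by (auto simp: rows_at_def array_at_Cons list_all2_Cons2)
next
  assume r: ?r
  then obtain ps where "array_at h b (Suc a) ps"
    "list_all2 (\<lambda>p es. array_at h b p (length es # pairs es)) ps ess"
    unfolding rows_at_def by blast
  then show ?l using r unfolding rows_at_def by (intro exI[of _ "h a # ps"]) (simp add: array_at_Cons)
qed

lemma rows_at_mono:
  assumes "rows_at h b a ess" "b \<le> b'" "\<And>x. x < b \<Longrightarrow> h' x = h x"
  shows "rows_at h' b' a ess"
proof -
  obtain ps where ps: "array_at h b a ps" "list_all2 (\<lambda>p es. array_at h b p (length es # pairs es)) ps ess"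
    using assms(1) by (auto simp: rows_at_def)
  have "list_all2 (\<lambda>p es. array_at h' b' p (length es # pairs es)) ps ess"
    using ps(2) by (rule list_all2_mono) (rule array_at_mono[OF _ assms(2,3)])
  then show ?thesis using array_at_mono[OF ps(1) assms(2,3)] by (auto simp: rows_at_def)
qed

text \<open>Register 7 holds the shift and register 29 points into the source row.\<close>

definition shift_entries :: com where
  "shift_entries = While 5 (Block [Load 4 29, Add 4 4 7, Store 2 4, Add 29 29 3, Add 2 2 3,
     Load 4 29, Store 2 4, Add 29 29 3, Add 2 2 3, Sub 5 5 3])"

text \<open>As in \<open>run_copy\<close>, the source stays below the write address. An entry takes
  ten instructions and two for loop control.\<close>

lemma run_shift_entries:
  assumes "array_at h (R 2) (R 29) (pairs es)" "length es = R 5" "R 3 = 1"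
  shows "\<exists>t. run shift_entries (R, h) (12 * length es + 1)
    (R(4 := t, 5 := 0, 29 := R 29 + 2 * length es, 2 := R 2 + 2 * length es),
     write_list h (R 2) (pairs (shift (R 7) es)))"
  using assms
proof (induction es arbitrary: R h)
  case Nil
  then have "R(4 := R 4, 5 := 0, 29 := R 29 + 2 * length [], 2 := R 2 + 2 * length []) = R" by auto
  then have "run shift_entries (R, h) (12 * length [] + 1)
    (R(4 := R 4, 5 := 0, 29 := R 29 + 2 * length [], 2 := R 2 + 2 * length []),
     write_list h (R 2) (pairs (shift (R 7) [])))"
    unfolding shift_entries_def using Nil by (auto intro!: run_While_zero_eq)
  then show ?case by blast
next
  case (Cons e es)
  obtain j x where e: "e = (j, x)" by (cases e)
  let ?R = "R(4 := x, 29 := Suc (Suc (R 29)), 2 := Suc (Suc (R 2)), 5 := R 5 - 1)"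
  let ?h = "h(R 2 := j + R 7, Suc (R 2) := x)"
  let ?R' = "\<lambda>t. R(4 := t, 5 := 0, 29 := R 29 + 2 * length (e # es), 2 := R 2 + 2 * length (e # es))"
  let ?h' = "write_list h (R 2) (pairs (shift (R 7) (e # es)))"
  have jx: "h (R 29) = j" "h (Suc (R 29)) = x" "Suc (R 29) < R 2"
    and es: "array_at h (R 2) (Suc (Suc (R 29))) (pairs es)"
    using Cons.prems by (simp_all add: array_at_Cons e)
  have body: "run (Block [Load 4 29, Add 4 4 7, Store 2 4, Add 29 29 3, Add 2 2 3,
     Load 4 29, Store 2 4, Add 29 29 3, Add 2 2 3, Sub 5 5 3]) (R, h) 10 (?R, ?h)"
    using Cons.prems jx by (intro run_Block_eq) auto
  have "array_at ?h (?R 2) (?R 29) (pairs es)" "length es = ?R 5" "?R 3 = 1"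
    using Cons.prems by (auto intro: array_at_mono[OF es])
  from Cons.IH[OF this] obtain t where "run shift_entries (?R, ?h) (12 * length es + 1)
      (?R(4 := t, 5 := 0, 29 := ?R 29 + 2 * length es, 2 := ?R 2 + 2 * length es),
       write_list ?h (?R 2) (pairs (shift (?R 7) es)))"
    by blast
  moreover have "?R(4 := t, 5 := 0, 29 := ?R 29 + 2 * length es, 2 := ?R 2 + 2 * length es) = ?R' t"
    by auto
  moreover have "write_list ?h (?R 2) (pairs (shift (?R 7) es)) = ?h'"
    by (simp add: write_list_Cons e)
  ultimately have "run shift_entries (?R, ?h) (12 * length es + 1) (?R' t, ?h')" by metis
  then have "run shift_entries (R, h) (12 * length (e # es) + 1) (?R' t, ?h')"
    unfolding shift_entries_def using body Cons.prems by (elim run_While_nonzero_eq[rotated 2]) auto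
  then show ?case by blast
qed

text \<open>Registers 22 and 27 run through the old and the new row pointers, register 26 counts the rows.\<close>

definition shift_rows :: com where
  "shift_rows = While 26 (Block [Load 29 22, Store 27 2, Add 22 22 3, Add 27 27 3, Sub 26 26 3,
     Load 5 29, Store 2 5, Add 29 29 3, Add 2 2 3] \<Zsemi> shift_entries)"

text \<open>Three zones: the source below \<open>b\<close>, reserved pointer slots from
  \<open>R 27\<close> to \<open>R 27 + R 26\<close>, and new rows from \<open>R 2\<close> on. Only
  unfilled slots and cells from \<open>R 2\<close> on may change, so slots already filled survive
  the remaining rounds. The constant 12 per row is nine instructions, the final test of the inner
  loop and two for the outer loop.\<close>

lemma run_shift_rows:
  assumes "rows_at h b (R 22) ess" "length ess = R 26" "R 3 = 1" "b \<le> R 27" "R 27 + R 26 \<le> R 2"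
  shows "\<exists>R' h'. run shift_rows (R, h) ((\<Sum>es\<leftarrow>ess. 12 * length es + 12) + 1) (R', h') \<and>
    (\<forall>r. r \<notin> {2, 4, 5, 22, 26, 27, 29} \<longrightarrow> R' r = R r) \<and> R 2 \<le> R' 2 \<and>
    (\<forall>x. x < R 27 \<or> R 27 + R 26 \<le> x \<and> x < R 2 \<longrightarrow> h' x = h x) \<and>
    rows_at h' (R' 2) (R 27) (map (shift (R 7)) ess)"
  using assms
proof (induction ess arbitrary: R h)
  case Nil
  then have "run shift_rows (R, h) ((\<Sum>es\<leftarrow>[]. 12 * length es + 12) + 1) (R, h)"
    unfolding shift_rows_def by (auto intro!: run_While_zero_eq)
  then show ?case using Nil by (intro exI conjI) (auto simp: rows_at_Nil)
next
  case (Cons es ess)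
  let ?p = "h (R 22)" and ?d = "R 2" and ?n = "length es"
  let ?R1 = "R(29 := Suc ?p, 22 := Suc (R 22), 27 := Suc (R 27), 26 := R 26 - 1, 5 := ?n, 2 := Suc ?d)"
  let ?h1 = "h(R 27 := ?d, ?d := ?n)"
  have row: "array_at h b ?p (?n # pairs es)" and rows: "rows_at h b (Suc (R 22)) ess" and "R 22 < b"
    using Cons.prems by (simp_all add: rows_at_Cons)
  then have p: "?p < b" "h ?p = ?n" "array_at h b (Suc ?p) (pairs es)" by (simp_all add: array_at_Cons)
  have bd: "R 27 < ?d" using Cons.prems by simp
  have head: "run (Block [Load 29 22, Store 27 2, Add 22 22 3, Add 27 27 3, Sub 26 26 3,
     Load 5 29, Store 2 5, Add 29 29 3, Add 2 2 3]) (R, h) 9 (?R1, ?h1)"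
    using Cons.prems p by (intro run_Block_eq) auto
  have "array_at ?h1 (?R1 2) (?R1 29) (pairs es)" "?n = ?R1 5" "?R1 3 = 1"
    using Cons.prems bd by (auto intro: array_at_mono[OF p(3)])
  from run_shift_entries[OF this] obtain t where entries: "run shift_entries (?R1, ?h1) (12 * ?n + 1)
      (?R1(4 := t, 5 := 0, 29 := ?R1 29 + 2 * ?n, 2 := ?R1 2 + 2 * ?n),
       write_list ?h1 (?R1 2) (pairs (shift (?R1 7) es)))" (is "run _ _ _ (?R2, ?h2)")
    by blast
  \<comment> \<open>The length cell and the shifted entries are adjacent, so the complete new row is
    a single contiguous write.\<close>
  have h2: "?h2 = write_list (h(R 27 := ?d)) ?d (?n # pairs (shift (R 7) es))"
    by (simp add: write_list_Cons)
  have below: "?h2 x = (if x = R 27 then ?d else h x)" if "x < ?d" for x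
    unfolding h2 using that by (simp add: write_list_below)
  have "rows_at ?h2 b (?R2 22) ess"
    using rows_at_mono[OF rows, of b ?h2] Cons.prems bd below by simp
  moreover have "?R2 27 + ?R2 26 \<le> ?R2 2" using Cons.prems by simp
  moreover have "length ess = ?R2 26" "?R2 3 = 1" "b \<le> ?R2 27" using Cons.prems by auto
  ultimately obtain R' h' where IH: "run shift_rows (?R2, ?h2) ((\<Sum>es\<leftarrow>ess. 12 * length es + 12) + 1) (R', h')"
    "\<forall>r. r \<notin> {2, 4, 5, 22, 26, 27, 29} \<longrightarrow> R' r = ?R2 r" "?R2 2 \<le> R' 2"
    "\<forall>x. x < ?R2 27 \<or> ?R2 27 + ?R2 26 \<le> x \<and> x < ?R2 2 \<longrightarrow> h' x = ?h2 x"
    "rows_at h' (R' 2) (?R2 27) (map (shift (?R2 7)) ess)"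
    using Cons.IH[of ?h2 ?R2] by blast
  have d': "Suc (?d + 2 * ?n) \<le> R' 2" using IH(3) by simp
  \<comment> \<open>The slot just filled and the row just written lie in the zone that the remaining
    rounds preserve.\<close>
  have frame: "h' x = ?h2 x" if "x \<le> R 27 \<or> R 27 + R 26 \<le> x \<and> x < Suc (?d + 2 * ?n)" for x
    using IH(4)[rule_format, of x] that Cons.prems by auto
  have "array_at ?h2 (Suc (?d + 2 * ?n)) ?d (?n # pairs (shift (R 7) es))"
    unfolding h2 using array_at_write_list[of "h(R 27 := ?d)" ?d "?n # pairs (shift (R 7) es)"] by simp
  then have "array_at h' (R' 2) ?d (?n # pairs (shift (R 7) es))"
    using d' frame Cons.prems by (auto simp: array_at_def)
  moreover have "h' (R 27) = ?d" using frame[of "R 27"] below[OF bd] by simp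
  moreover have "rows_at h' (R' 2) (Suc (R 27)) (map (shift (R 7)) ess)" using IH(5) by simp
  ultimately have "rows_at h' (R' 2) (R 27) (map (shift (R 7)) (es # ess))"
    using bd d' by (simp add: rows_at_Cons)
  moreover have "run shift_rows (R, h) ((\<Sum>es\<leftarrow>es # ess. 12 * length es + 12) + 1) (R', h')"
    unfolding shift_rows_def
    by (rule run_While_nonzero_eq[OF _ run_Seq[OF head entries] IH(1)[unfolded shift_rows_def]])
      (use Cons.prems in auto)
  moreover have "\<forall>x. x < R 27 \<or> R 27 + R 26 \<le> x \<and> x < R 2 \<longrightarrow> h' x = h x"
    using frame below bd Cons.prems by auto
  moreover have "\<forall>r. r \<notin> {2, 4, 5, 22, 26, 27, 29} \<longrightarrow> R' r = R r" using IH(2) by simp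
  moreover have "R 2 \<le> R' 2" using d' by simp
  ultimately show ?case by blast
qed


section \<open>Arranging the row pointers of two matrices\<close>

text \<open>Consecutive copies extend one array starting at \<open>d\<close>: \<open>ws\<close> is
  its content before and \<open>zs\<close> after the copy. The equational premises absorb the
  different forms in which the callers have these values.\<close>

lemma run_copy_append:
  assumes "array_at h d (R r) xs" "length xs = R 5" "R 3 = 1" "5 < r" "R 2 = d + length ws"
    and "h1 = write_list h d ws" "zs = ws @ xs" "n = 7 * length xs + 1" "p = R r + length xs"
  shows "\<exists>t. run (copy r) (R, h1) n (R(4 := t, 5 := 0, r := p, 2 := d + length zs), write_list h d zs)"
proof -
  have "array_at h1 (R 2) (R r) xs"
    using assms(1) by (rule array_at_mono) (simp_all add: assms(5,6) write_list_below)
  from run_copy[OF this assms(2-4)] show ?thesis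
    by (simp add: assms(5-9) write_list_append add.assoc)
qed

definition interleave :: "nat \<Rightarrow> nat \<Rightarrow> 'a list \<Rightarrow> 'a list \<Rightarrow> 'a list" where
  "interleave a c xs ys = take a xs @ take c ys @ drop a xs @ drop c ys"

lemma length_interleave [simp]: "length (interleave a c xs ys) = length xs + length ys"
  by (simp add: interleave_def)

text \<open>
  Registers 21 and 22 point to the row pointers of the two matrices, 7 and 8 hold their sizes, and 23 and 24
  the two splitting points; the row pointers of the result start at the address in register 25.
\<close>

definition build :: com where
  "build = Block [Move 26 8, Move 27 2, Move 28 2, Add 2 2 8] \<Zsemi> shift_rows \<Zsemi>
     Block [Move 25 2, Move 5 23] \<Zsemi> copy 21 \<Zsemi> Block [Move 5 24] \<Zsemi> copy 28 \<Zsemi>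
     Block [Sub 5 7 23] \<Zsemi> copy 21 \<Zsemi> Block [Sub 5 8 24] \<Zsemi> copy 28"

text \<open>The second copy from each source resumes where the first stopped, so every pointer is
  copied once and the time does not depend on the splitting points. The registers below 21 hold the
  headers, hence their preservation.\<close>

lemma run_build:
  assumes f: "rows_at h (R 2) (R 21) fs" "length fs = R 7" "R 23 \<le> R 7"
    and g: "rows_at h (R 2) (R 22) gs" "length gs = R 8" "R 24 \<le> R 8" and one: "R 3 = 1"
  shows "\<exists>R' h'. run build (R, h) ((\<Sum>es\<leftarrow>gs. 12 * length es + 12) + 7 * (R 7 + R 8) + 14) (R', h') \<and>
    (\<forall>r<21. r \<notin> {2, 4, 5} \<longrightarrow> R' r = R r) \<and> R 2 \<le> R' 2 \<and> (\<forall>x<R 2. h' x = h x) \<and>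
    rows_at h' (R' 2) (R' 25) (interleave (R 23) (R 24) fs (map (shift (R 7)) gs))"
proof -
  let ?a = "R 23" and ?c = "R 24" and ?gs = "map (shift (R 7)) gs"
  let ?P = "\<lambda>h b p es. array_at h b p (length es # pairs es)"
  \<comment> \<open>The first \<open>R 8\<close> free cells are reserved for the pointers to the
    shifted rows. Register 27 advances while they are filled; register 28 keeps their start for the
    later copies.\<close>
  let ?R0 = "R(26 := R 8, 27 := R 2, 28 := R 2, 2 := R 2 + R 8)"
  have init: "run (Block [Move 26 8, Move 27 2, Move 28 2, Add 2 2 8]) (R, h) 4 (?R0, h)"
    by (intro run_Block_eq) auto
  obtain R1 h1 where shift: "run shift_rows (?R0, h) ((\<Sum>es\<leftarrow>gs. 12 * length es + 12) + 1) (R1, h1)"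
    and R1: "\<And>r. r \<notin> {2, 4, 5, 22, 26, 27, 29} \<Longrightarrow> R1 r = ?R0 r" "R 2 + R 8 \<le> R1 2"
    and h1: "\<And>x. x < R 2 \<Longrightarrow> h1 x = h x" and gs1: "rows_at h1 (R1 2) (R 2) ?gs"
  proof -
    have "rows_at h (R 2) (?R0 22) gs" "length gs = ?R0 26" "?R0 3 = 1" "R 2 \<le> ?R0 27"
      "?R0 27 + ?R0 26 \<le> ?R0 2" using g one by simp_all
    from run_shift_rows[OF this] obtain R1 h1 where A:
      "run shift_rows (?R0, h) ((\<Sum>es\<leftarrow>gs. 12 * length es + 12) + 1) (R1, h1)"
      "\<forall>r. r \<notin> {2, 4, 5, 22, 26, 27, 29} \<longrightarrow> R1 r = ?R0 r" "?R0 2 \<le> R1 2"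
      "\<forall>x. x < ?R0 27 \<or> ?R0 27 + ?R0 26 \<le> x \<and> x < ?R0 2 \<longrightarrow> h1 x = h x"
      "rows_at h1 (R1 2) (?R0 27) (map (shift (?R0 7)) gs)" by blast
    show ?thesis
      by (rule that[OF A(1)]) (use A(2-5) in \<open>simp_all split del: if_split\<close>)
  qed
  let ?d = "R1 2"
  have fs1: "rows_at h1 ?d (R 21) fs" using R1(2) h1 by (intro rows_at_mono[OF f(1)]) auto
  \<comment> \<open>The pointer lists are made explicit, since the remaining code moves pointers and
    leaves the rows in place.\<close>
  obtain ps where ps: "array_at h1 ?d (R 21) ps" "list_all2 (?P h1 ?d) ps fs"
    using fs1 unfolding rows_at_def by blast
  obtain qs where qs: "array_at h1 ?d (R 2) qs" "list_all2 (?P h1 ?d) qs ?gs"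
    using gs1 unfolding rows_at_def by blast
  have len: "length ps = R 7" "length qs = R 8"
    using ps(2) qs(2) f(2) g(2) by (auto dest: list_all2_lengthD)
  have P: "array_at h1 ?d (R 21) (take ?a ps)" "array_at h1 ?d (R 21 + ?a) (drop ?a ps)"
    using ps(1) array_at_append[of h1 ?d "R 21" "take ?a ps" "drop ?a ps"] len f(3) by simp_all
  have Q: "array_at h1 ?d (R 2) (take ?c qs)" "array_at h1 ?d (R 2 + ?c) (drop ?c qs)"
    using qs(1) array_at_append[of h1 ?d "R 2" "take ?c qs" "drop ?c qs"] len g(3) by simp_all
  note [simp] = R1(1) len one f(3) g(3) min_absorb2
  \<comment> \<open>The content of the result array after each of the four copies.\<close>
  let ?w1 = "take ?a ps" let ?w2 = "?w1 @ take ?c qs"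
  let ?w3 = "?w2 @ drop ?a ps" let ?w4 = "?w3 @ drop ?c qs"
  let ?B2 = "R1(25 := ?d, 5 := ?a)"
  have b2: "run (Block [Move 25 2, Move 5 23]) (R1, h1) 2 (?B2, h1)"
    by (intro run_Block_eq) auto
  have "\<exists>t. run (copy 21) (?B2, h1) (7 * ?a + 1)
      (?B2(4 := t, 5 := 0, 21 := R 21 + ?a, 2 := ?d + length ?w1), write_list h1 ?d ?w1)" (is "\<exists>t. run _ _ _ (?R2 t, ?h2)")
    by (rule run_copy_append[where xs = "take ?a ps" and ws = "[]"]) (use P in auto)
  then obtain t2 where c2: "run (copy 21) (?B2, h1) (7 * ?a + 1) (?R2 t2, ?h2)" by (rule exE)
  let ?B3 = "(?R2 t2)(5 := ?c)"
  have b3: "run (Block [Move 5 24]) (?R2 t2, ?h2) 1 (?B3, ?h2)"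
    by (intro run_Block_eq) auto
  have "\<exists>t. run (copy 28) (?B3, ?h2) (7 * ?c + 1)
      (?B3(4 := t, 5 := 0, 28 := R 2 + ?c, 2 := ?d + length ?w2), write_list h1 ?d ?w2)" (is "\<exists>t. run _ _ _ (?R3 t, ?h3)")
    by (rule run_copy_append[where xs = "take ?c qs" and ws = ?w1]) (use Q in auto)
  then obtain t3 where c3: "run (copy 28) (?B3, ?h2) (7 * ?c + 1) (?R3 t3, ?h3)" by (rule exE)
  let ?B4 = "(?R3 t3)(5 := R 7 - ?a)"
  have b4: "run (Block [Sub 5 7 23]) (?R3 t3, ?h3) 1 (?B4, ?h3)"
    by (intro run_Block_eq) auto
  have "\<exists>t. run (copy 21) (?B4, ?h3) (7 * (R 7 - ?a) + 1)
      (?B4(4 := t, 5 := 0, 21 := R 21 + ?a + (R 7 - ?a), 2 := ?d + length ?w3), write_list h1 ?d ?w3)" (is "\<exists>t. run _ _ _ (?R4 t, ?h4)")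
    by (rule run_copy_append[where xs = "drop ?a ps" and ws = ?w2]) (use P in auto)
  then obtain t4 where c4: "run (copy 21) (?B4, ?h3) (7 * (R 7 - ?a) + 1) (?R4 t4, ?h4)" by (rule exE)
  let ?B5 = "(?R4 t4)(5 := R 8 - ?c)"
  have b5: "run (Block [Sub 5 8 24]) (?R4 t4, ?h4) 1 (?B5, ?h4)"
    by (intro run_Block_eq) auto
  have "\<exists>t. run (copy 28) (?B5, ?h4) (7 * (R 8 - ?c) + 1)
      (?B5(4 := t, 5 := 0, 28 := R 2 + ?c + (R 8 - ?c), 2 := ?d + length ?w4), write_list h1 ?d ?w4)" (is "\<exists>t. run _ _ _ (?R5 t, ?h5)")
    by (rule run_copy_append[where xs = "drop ?c qs" and ws = ?w3]) (use Q in auto)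
  then obtain t5 where c5: "run (copy 28) (?B5, ?h4) (7 * (R 8 - ?c) + 1) (?R5 t5, ?h5)" by (rule exE)
  have "run build (R, h) ((\<Sum>es\<leftarrow>gs. 12 * length es + 12) + 7 * (R 7 + R 8) + 14) (?R5 t5, ?h5)"
    unfolding build_def
    by (rule run_Seq_eq[OF init run_Seq[OF shift run_Seq[OF b2 run_Seq[OF c2 run_Seq[OF b3
          run_Seq[OF c3 run_Seq[OF b4 run_Seq[OF c4 run_Seq[OF b5 c5]]]]]]]]])
      \<comment> \<open>The bounds on the splitting points make the truncated differences add up to
        the full sizes.\<close>
      (simp, use f(3) g(3) in arith)
  moreover have "\<forall>r<21. r \<notin> {2, 4, 5} \<longrightarrow> ?R5 t5 r = R r" by auto
  moreover have "R 2 \<le> ?R5 t5 2" using R1(2) by simp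
  moreover have "\<forall>x<R 2. ?h5 x = h x" using R1(2) h1 by (simp add: write_list_below)
  moreover have "rows_at ?h5 (?R5 t5 2) (?R5 t5 25) (interleave ?a ?c fs ?gs)"
  proof -
    have w4: "?w4 = interleave ?a ?c ps qs" by (simp add: interleave_def)
    have "list_all2 (?P h1 ?d) ?w4 (interleave ?a ?c fs ?gs)"
      unfolding w4 interleave_def
      by (intro list_all2_appendI list_all2_takeI list_all2_dropI ps(2) qs(2))
    then have "list_all2 (?P ?h5 (?d + length ?w4)) ?w4 (interleave ?a ?c fs ?gs)"
      by (rule list_all2_mono) (auto elim!: array_at_mono simp: write_list_below simp del: array_at_Cons)
    moreover have "array_at ?h5 (?d + length ?w4) ?d ?w4" by (rule array_at_write_list)
    ultimately show ?thesis unfolding rows_at_def by (intro exI[of _ ?w4]) simp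
  qed
  ultimately show ?thesis by blast
qed


section \<open>Sparse matrices\<close>

definition is_row :: "nat mat \<Rightarrow> nat \<Rightarrow> row \<Rightarrow> bool" where
  "is_row A i es \<longleftrightarrow> distinct es \<and> set es = {(j, A $$ (i, j)) |j. j < dim_col A \<and> A $$ (i, j) \<noteq> 0}"

definition is_rows :: "nat mat \<Rightarrow> row list \<Rightarrow> bool" where
  "is_rows A ess \<longleftrightarrow> length ess = dim_row A \<and> (\<forall>i<dim_row A. is_row A i (ess ! i))"

text \<open>Separates what is stored from where it is stored: the programs are verified with
  \<open>rows_at\<close>, the matrix identities with \<open>is_rows\<close>.\<close>

lemma sparse_mat_at_iff: "sparse_mat_at h b a A \<longleftrightarrow> (\<exists>ess. is_rows A ess \<and> rows_at h b a ess)"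
  (is "?l \<longleftrightarrow> ?r")
proof
  assume ?l
  then obtain ps where ps: "length ps = dim_row A" "array_at h b a ps" "\<forall>i<dim_row A. row_at h b (ps ! i) A i"
    by (auto simp: sparse_mat_at_def)
  then have "\<forall>i<dim_row A. \<exists>es. is_row A i es \<and> array_at h b (ps ! i) (length es # pairs es)"
    by (simp add: row_at_def is_row_def pairs_def conj_assoc)
  then obtain ess where "length ess = dim_row A"
    "\<forall>i<dim_row A. is_row A i (ess ! i) \<and> array_at h b (ps ! i) (length (ess ! i) # pairs (ess ! i))"
    unfolding Skolem_list_nth by blast
  then show ?r using ps(1,2)
    unfolding rows_at_def is_rows_def list_all2_conv_all_nth by (intro exI[of _ ess] conjI exI[of _ ps]) auto
next
  assume ?r
  then obtain ess ps where "is_rows A ess" "array_at h b a ps"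
    "list_all2 (\<lambda>p es. array_at h b p (length es # pairs es)) ps ess"
    by (auto simp: rows_at_def)
  then show ?l unfolding sparse_mat_at_def
    by (intro exI[of _ ps])
      (auto simp: is_rows_def list_all2_conv_all_nth row_at_def is_row_def pairs_def)
qed

text \<open>A row lists every non-zero column exactly once, so its length is the number of these
  columns.\<close>

lemma length_row_le:
  assumes "is_rows A ess" "es \<in> set ess" "\<And>i. i < dim_row A \<Longrightarrow> card {j. j < dim_col A \<and> A $$ (i, j) \<noteq> 0} \<le> w"
  shows "length es \<le> w"
proof -
  obtain i where i: "i < dim_row A" "is_row A i es"
    using assms(1,2) by (auto simp: is_rows_def in_set_conv_nth)
  then have "length es = card ((\<lambda>j. (j, A $$ (i, j))) ` {j. j < dim_col A \<and> A $$ (i, j) \<noteq> 0})"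
    by (simp add: is_row_def distinct_card[symmetric] image_Collect)
  also have "\<dots> \<le> card {j. j < dim_col A \<and> A $$ (i, j) \<noteq> 0}" by (rule card_image_le) simp
  finally show ?thesis using assms(3)[OF i(1)] by simp
qed

text \<open>Zeros are not stored, so padding leaves the rows of \<open>A\<close> as they are and
  only moves the column indices of \<open>B\<close> by \<open>k\<close>.\<close>

lemma is_rows_dsum:
  assumes A: "A \<in> carrier_mat k k" "is_rows A fs" and B: "B \<in> carrier_mat l l" "is_rows B gs"
  shows "is_rows (A \<oplus>\<^sub>m B) (fs @ map (shift k) gs)"
proof -
  have "is_row (A \<oplus>\<^sub>m B) i ((fs @ map (shift k) gs) ! i)" if i: "i < k + l" for i
  proof (cases "i < k")
    case True
    then have "is_row A i (fs ! i)" "length fs = k" using A by (auto simp: is_rows_def)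
    then show ?thesis using A B True by (auto simp: is_row_def mat_dsum_index nth_append split: if_splits)
  next
    case False
    then have r: "is_row B (i - k) (gs ! (i - k))" and len: "length fs = k" "length gs = l"
      using A B i by (auto simp: is_rows_def)
    have "set (shift k es) = (\<lambda>(j, x). (j + k, x)) ` set es" for es by (simp add: shift_def)
    moreover have "distinct (shift k es)" if "distinct es" for es
      using that by (auto simp: shift_def distinct_map inj_on_def)
    moreover have "(\<lambda>(j, x). (j + k, x)) ` {(j, B $$ (i - k, j)) |j. j < l \<and> B $$ (i - k, j) \<noteq> 0} =
        {(j, (A \<oplus>\<^sub>m B) $$ (i, j)) |j. j < k + l \<and> (A \<oplus>\<^sub>m B) $$ (i, j) \<noteq> 0}" (is "?f ` ?X = ?Y")
    proof (intro equalityI subsetI)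
      fix y assume "y \<in> ?f ` ?X"
      then obtain j where "j < l" "B $$ (i - k, j) \<noteq> 0" "y = (j + k, B $$ (i - k, j))" by auto
      then show "y \<in> ?Y" using A B i False by (auto simp: mat_dsum_index)
    next
      fix y assume "y \<in> ?Y"
      then obtain j where j: "j < k + l" "(A \<oplus>\<^sub>m B) $$ (i, j) \<noteq> 0" "y = (j, (A \<oplus>\<^sub>m B) $$ (i, j))" by auto
      then have "k \<le> j" "(A \<oplus>\<^sub>m B) $$ (i, j) = B $$ (i - k, j - k)"
        using A B i False by (auto simp: mat_dsum_index split: if_splits)
      then show "y \<in> ?f ` ?X" using j by (intro image_eqI[of _ _ "(j - k, B $$ (i - k, j - k))"]) auto
    qed
    ultimately show ?thesis using r len A B i False by (simp add: is_row_def nth_append)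
  qed
  then show ?thesis using A B by (simp add: is_rows_def)
qed

section \<open>Permuted rows and row lengths\<close>

text \<open>Since \<open>block_perm\<close> is the index map of the permutation matrices in
  \<open>har_tensor\<close>, this links the order of the four copied segments to those
  matrices.\<close>

lemma nth_interleave:
  assumes "a \<le> length xs" "c \<le> length ys" "i < length xs + length ys"
  shows "interleave a c xs ys ! i = (xs @ ys) ! block_perm a (length xs - a) c i"
  using assms by (auto simp: interleave_def block_perm_def nth_append min_def
      intro!: arg_cong[of _ _ "nth _"])

lemma permutation_mat_row_card:
  assumes "permutation_mat k P" "i < k"
  shows "card {j. j < k \<and> bool_to_nat_mat P $$ (i, j) \<noteq> 0} \<le> 1"
proof -
  obtain j where "\<forall>j'. j' < k \<and> P $$ (i, j') \<longrightarrow> j' = j" using permutation_mat_row[OF assms] by blast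
  then have "{j. j < k \<and> bool_to_nat_mat P $$ (i, j) \<noteq> 0} \<subseteq> {j}"
    using permutation_mat_carrier[OF assms(1)] assms(2) by auto
  then show ?thesis using card_mono[of "{j}"] by simp
qed

text \<open>In diagrammatic order the permutation matrix multiplies from the left, so it only
  selects rows: row \<open>i\<close> of the composite is row \<open>?p i\<close> of the direct sum.
  The splitting points are general in order to serve both interfaces.\<close>

lemma is_rows_perm_tensor:
  assumes P: "permutation_mat k P" "is_rows (bool_to_nat_mat P) fs" "a \<le> k"
    and Q: "permutation_mat l Q" "is_rows (bool_to_nat_mat Q) gs" "c \<le> l"
  shows "is_rows (bool_to_nat_mat ((P \<oplus>\<^sub>m Q) ;; (1\<^sub>m a \<oplus>\<^sub>m \<sigma>\<^sub>m (k - a) c \<oplus>\<^sub>m 1\<^sub>m (l - c))))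
    (interleave a c fs (map (shift k) gs))" (is "is_rows (bool_to_nat_mat ?C) _")
proof -
  let ?D = "bool_to_nat_mat P \<oplus>\<^sub>m bool_to_nat_mat Q" and ?p = "block_perm a (k - a) c"
  have kl: "a + (k - a) + c + (l - c) = k + l" using P Q by simp
  have car: "P \<in> carrier_mat k k" "Q \<in> carrier_mat l l"
    using P Q by (auto dest: permutation_mat_carrier)
  have len: "length fs = k" "length gs = l" using P(2) Q(2) car by (auto simp: is_rows_def)
  have PQ: "P \<oplus>\<^sub>m Q \<in> carrier_mat (k + l) (k + l)" using car by (intro carrier_matI) simp_all
  have "permutation_mat (k + l) ?C"
    using permutation_mat_block_perm_seq[of a "k - a" c "l - c", unfolded kl] permutation_mat_dsum[OF P(1) Q(1)] .
  then have C: "?C \<in> carrier_mat (k + l) (k + l)" by (rule permutation_mat_carrier)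
  have D: "is_rows ?D (fs @ map (shift k) gs)"
    using P Q car by (intro is_rows_dsum[of _ k _ _ l]) auto
  have pb: "?p i < k + l" if "i < k + l" for i using block_perm_bound[of i a "k - a" c "l - c"] that kl by simp
  have CD: "bool_to_nat_mat ?C $$ (i, j) = ?D $$ (?p i, j)" if "i < k + l" "j < k + l" for i j
    using block_perm_seq_index[of _ a "k - a" c "l - c", unfolded kl, OF PQ that] that pb[of i] C car
    by (auto simp: mat_dsum_index zero_bool_def)
  have "is_row (bool_to_nat_mat ?C) i (interleave a c fs (map (shift k) gs) ! i)" if i: "i < k + l" for i
  proof -
    have "is_row ?D (?p i) ((fs @ map (shift k) gs) ! ?p i)"
      using D pb[OF i] car by (simp add: is_rows_def)
    moreover have "interleave a c fs (map (shift k) gs) ! i = (fs @ map (shift k) gs) ! ?p i"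
      using nth_interleave[of a fs c "map (shift k) gs" i] len P Q i by simp
    moreover have "dim_col ?C = k + l" using C by auto
    ultimately show ?thesis using CD[OF i] car by (auto simp: is_row_def simp del: index_map_mat(1))
  qed
  then show ?thesis using C len by (auto simp: is_rows_def)
qed

text \<open>Row \<open>v\<close> records the edges into \<open>v\<close>: at most one at a
  \<open>Bullet\<close>, and \<open>arity\<close> many at an operation. The sum over the finite
  signature bounds every arity, and covers the empty signature as well.\<close>

lemma is_har_row_card:
  assumes har: "is_har \<Sigma> n m f" and fin: "finite (ops \<Sigma>)" and v: "v < har_size f"
  shows "card {j. j < har_size f \<and> har_mat f $$ (v, j) \<noteq> 0} \<le> 1 + (\<Sum>o'\<in>ops \<Sigma>. arity \<Sigma> o')"
proof -
  have E: "{j. j < har_size f \<and> har_mat f $$ (v, j) \<noteq> 0} = {j. (j, v) \<in> har_edges f}"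
    using v by (auto simp: har_edges_def)
  show ?thesis
  proof (cases "har_lab f ! v")
    case Bullet
    then have "card {j. (j, v) \<in> har_edges f} \<le> 1" using is_harD(7)[OF har] v by blast
    then show ?thesis using E by simp
  next
    case (Circ g)
    then have g: "g \<in> ops \<Sigma>" "bij_betw (\<lambda>j. har_mat f $$ (v, j)) {j. (j, v) \<in> har_edges f} {1..arity \<Sigma> g}"
      using is_harD(12)[OF har] v by auto
    then have "card {j. (j, v) \<in> har_edges f} = arity \<Sigma> g" using bij_betw_same_card by force
    then show ?thesis using member_le_sum[OF g(1), of "arity \<Sigma>"] fin E by simp
  qed
qed

lemma is_har_interface_le:
  assumes "is_har \<Sigma> n m f"
  shows "n \<le> har_size f" "m \<le> har_size f"
proof -
  have "left_nodes f \<subseteq> {..<har_size f}" "right_nodes f \<subseteq> {..<har_size f}"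
    by (auto simp: left_nodes_def right_nodes_def)
  from card_mono[OF _ this(1)] card_mono[OF _ this(2)] show "n \<le> har_size f" "m \<le> har_size f"
    using is_harD(8,10)[OF assms] by simp_all
qed


section \<open>The tensor product program\<close>

text \<open>
  The header entries of \<open>f\<close> go to registers 7 and 9--14, those of \<open>g\<close> to 8 and 15--20, so the pointer of \<open>g\<close>
  that corresponds to register \<open>r\<close> is in register \<open>r + 6\<close>. The pointers of the result replace those of \<open>f\<close>.
\<close>

definition load_headers :: com where
  "load_headers = Block [Const 3 1,
     Load 7 0, Add 0 0 3, Load 9 0, Add 0 0 3, Load 10 0, Add 0 0 3, Load 11 0, Add 0 0 3,
     Load 12 0, Add 0 0 3, Load 13 0, Add 0 0 3, Load 14 0,
     Load 8 1, Add 1 1 3, Load 15 1, Add 1 1 3, Load 16 1, Add 1 1 3, Load 17 1, Add 1 1 3,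
     Load 18 1, Add 1 1 3, Load 19 1, Add 1 1 3, Load 20 1]"

lemma run_load_headers:
  assumes "array_at h b (R 0) [k, n1, m1, aM, aL, aR, aN]" "array_at h b (R 1) [l, n2, m2, bM, bL, bR, bN]"
  shows "run load_headers (R, h) 27
    (R(3 := 1, 7 := k, 9 := n1, 10 := m1, 11 := aM, 12 := aL, 13 := aR, 0 := R 0 + 6, 14 := aN,
       8 := l, 15 := n2, 16 := m2, 17 := bM, 18 := bL, 19 := bR, 1 := R 1 + 6, 20 := bN), h)"
proof -
  have 6: "x + 6 = Suc (Suc (Suc (Suc (Suc (Suc x)))))" for x by simp
  then show ?thesis
    using assms unfolding load_headers_def by (intro run_Block_eq) (simp_all add: array_at_Cons 6)
qed

text \<open>The three matrices differ only in their splitting points, which the instructions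
  \<open>is\<close> put into registers 23 and 24.\<close>

definition stage :: "nat \<Rightarrow> instr list \<Rightarrow> com" where
  "stage r is = Block (Move 21 r # Move 22 (r + 6) # is) \<Zsemi> build \<Zsemi> Block [Move r 25]"

text \<open>The two alternatives for \<open>is\<close> cover splitting points read off directly
  (adjacency matrix, left permutation) and those counted from the end (right permutation).\<close>

lemma run_stage:
  assumes "is = [Move 23 u, Move 24 v] \<and> a = R u \<and> c = R v \<or>
      is = [Sub 23 7 u, Sub 24 8 v] \<and> a = R 7 - R u \<and> c = R 8 - R v"
    and uv: "u < 21" "v < 21" and r: "5 < r" "r < 15" "r \<notin> {7, 8}"
    and f: "rows_at h (R 2) (R r) fs" "length fs = R 7" "a \<le> R 7"
    and g: "rows_at h (R 2) (R (r + 6)) gs" "length gs = R 8" "c \<le> R 8" and one: "R 3 = 1"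
  shows "\<exists>R' h'. run (stage r is) (R, h) ((\<Sum>es\<leftarrow>gs. 12 * length es + 12) + 7 * (R 7 + R 8) + 19) (R', h') \<and>
    (\<forall>q<21. q \<notin> {2, 4, 5, r} \<longrightarrow> R' q = R q) \<and> R 2 \<le> R' 2 \<and> (\<forall>x<R 2. h' x = h x) \<and>
    rows_at h' (R' 2) (R' r) (interleave a c fs (map (shift (R 7)) gs))"
proof -
  let ?R0 = "R(21 := R r, 22 := R (r + 6), 23 := a, 24 := c)"
  have init: "run (Block (Move 21 r # Move 22 (r + 6) # is)) (R, h) 4 (?R0, h)"
    using assms(1) uv r by (intro run_Block_eq) auto
  have "rows_at h (?R0 2) (?R0 21) fs" "length fs = ?R0 7" "?R0 23 \<le> ?R0 7"
    "rows_at h (?R0 2) (?R0 22) gs" "length gs = ?R0 8" "?R0 24 \<le> ?R0 8" "?R0 3 = 1"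
    using f g one by simp_all
  from run_build[OF this] obtain R1 h1 where b:
    "run build (?R0, h) ((\<Sum>es\<leftarrow>gs. 12 * length es + 12) + 7 * (?R0 7 + ?R0 8) + 14) (R1, h1)"
    "\<forall>r<21. r \<notin> {2, 4, 5} \<longrightarrow> R1 r = ?R0 r" "?R0 2 \<le> R1 2" "\<forall>x<?R0 2. h1 x = h x"
    "rows_at h1 (R1 2) (R1 25) (interleave (?R0 23) (?R0 24) fs (map (shift (?R0 7)) gs))"
    by blast
  have last: "run (Block [Move r 25]) (R1, h1) 1 (R1(r := R1 25), h1)" by (intro run_Block_eq) auto
  have "run (stage r is) (R, h) ((\<Sum>es\<leftarrow>gs. 12 * length es + 12) + 7 * (R 7 + R 8) + 19) (R1(r := R1 25), h1)"
    unfolding stage_def by (rule run_Seq_eq[OF init run_Seq[OF b(1) last]]) simp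
  then show ?thesis using b(2-5) r
    by (intro exI[of _ "R1(r := R1 25)"] exI[of _ h1]) auto
qed

definition copy_labels :: com where
  "copy_labels = Block [Move 25 2, Move 5 7] \<Zsemi> copy 14 \<Zsemi> Block [Move 5 8] \<Zsemi> copy 20 \<Zsemi> Block [Move 14 25]"

text \<open>Registers 15 and 16 hold the type of \<open>g\<close>, which the header of the result
  still needs.\<close>

lemma run_copy_labels:
  assumes "array_at h (R 2) (R 14) xs" "length xs = R 7"
    and "array_at h (R 2) (R 20) ys" "length ys = R 8" and one: "R 3 = 1"
  shows "\<exists>R' h'. run copy_labels (R, h) (7 * (R 7 + R 8) + 6) (R', h') \<and>
    (\<forall>q<14. q \<notin> {2, 4, 5} \<longrightarrow> R' q = R q) \<and> R' 15 = R 15 \<and> R' 16 = R 16 \<and> R 2 \<le> R' 2 \<and>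
    (\<forall>x<R 2. h' x = h x) \<and> array_at h' (R' 2) (R' 14) (xs @ ys)"
proof -
  let ?d = "R 2"
  let ?B1 = "R(25 := ?d, 5 := R 7)"
  have b1: "run (Block [Move 25 2, Move 5 7]) (R, h) 2 (?B1, h)" by (intro run_Block_eq) auto
  have "\<exists>t. run (copy 14) (?B1, h) (7 * R 7 + 1)
      (?B1(4 := t, 5 := 0, 14 := R 14 + R 7, 2 := ?d + length xs), write_list h ?d xs)"
    (is "\<exists>t. run _ _ _ (?R1 t, ?h1)")
    by (rule run_copy_append[where xs = xs and ws = "[]"]) (use assms in auto)
  then obtain t1 where c1: "run (copy 14) (?B1, h) (7 * R 7 + 1) (?R1 t1, ?h1)" by (rule exE)
  let ?B2 = "(?R1 t1)(5 := R 8)"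
  have b2: "run (Block [Move 5 8]) (?R1 t1, ?h1) 1 (?B2, ?h1)" by (intro run_Block_eq) auto
  have "\<exists>t. run (copy 20) (?B2, ?h1) (7 * R 8 + 1)
      (?B2(4 := t, 5 := 0, 20 := R 20 + R 8, 2 := ?d + length (xs @ ys)), write_list h ?d (xs @ ys))"
    (is "\<exists>t. run _ _ _ (?R2 t, ?h2)")
    by (rule run_copy_append[where xs = ys and ws = xs]) (use assms in auto)
  then obtain t2 where c2: "run (copy 20) (?B2, ?h1) (7 * R 8 + 1) (?R2 t2, ?h2)" by (rule exE)
  have b3: "run (Block [Move 14 25]) (?R2 t2, ?h2) 1 ((?R2 t2)(14 := ?d), ?h2)"
    by (intro run_Block_eq) auto
  have "run copy_labels (R, h) (7 * (R 7 + R 8) + 6) ((?R2 t2)(14 := ?d), ?h2)"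
    unfolding copy_labels_def
    by (rule run_Seq_eq[OF b1 run_Seq[OF c1 run_Seq[OF b2 run_Seq[OF c2 b3]]]]) simp
  then show ?thesis
    using array_at_write_list[of h ?d "xs @ ys"]
    by (intro exI[of _ "(?R2 t2)(14 := ?d)"] exI[of _ ?h2]) (auto simp: write_list_below)
qed

definition write_header :: com where
  "write_header = Block [Add 7 7 8, Add 9 9 15, Add 10 10 16, Move 0 2,
     Store 2 7, Add 2 2 3, Store 2 9, Add 2 2 3, Store 2 10, Add 2 2 3, Store 2 11, Add 2 2 3,
     Store 2 12, Add 2 2 3, Store 2 13, Add 2 2 3, Store 2 14]"

lemma run_write_header:
  assumes "R 3 = 1"
  shows "run write_header (R, h) 17
    (R(7 := R 7 + R 8, 9 := R 9 + R 15, 10 := R 10 + R 16, 0 := R 2, 2 := R 2 + 6),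
     write_list h (R 2) [R 7 + R 8, R 9 + R 15, R 10 + R 16, R 11, R 12, R 13, R 14])"
proof -
  have 6: "x + 6 = Suc (Suc (Suc (Suc (Suc (Suc x)))))" for x by simp
  then show ?thesis
    using assms unfolding write_header_def by (intro run_Block_eq) (simp_all add: write_list_Cons 6)
qed

definition tensor_program :: com where
  "tensor_program = load_headers \<Zsemi> stage 11 [Move 23 7, Move 24 8] \<Zsemi>
     stage 12 [Move 23 9, Move 24 15] \<Zsemi> stage 13 [Sub 23 7 10, Sub 24 8 16] \<Zsemi>
     copy_labels \<Zsemi> write_header"

lemma sum_list_row_cost_le:
  assumes "\<forall>es\<in>set ess. length es \<le> w"
  shows "(\<Sum>es\<leftarrow>ess. 12 * length es + 12) \<le> (12 * w + 12) * length ess"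
  using assms by (induction ess) auto

text \<open>The program only writes to cells not below register 2, whose value only increases; data below that
  address therefore survive.\<close>

lemma run_tensor_program:
  assumes har: "is_har \<Sigma> n1 m1 f" "is_har \<Sigma> n2 m2 g" and fin: "finite (ops \<Sigma>)"
    and f: "har_at code h (R 2) (R 0) n1 m1 f" and g: "har_at code h (R 2) (R 1) n2 m2 g"
    and w: "w = 1 + (\<Sum>o'\<in>ops \<Sigma>. arity \<Sigma> o')"
  shows "\<exists>t R' h' b. run tensor_program (R, h) t (R', h') \<and>
    t \<le> 3 * ((12 * w + 12) * har_size g) + 28 * (har_size f + har_size g) + 107 \<and>
    har_at code h' b (R' 0) (n1 + n2) (m1 + m2) (har_tensor n1 m1 n2 m2 f g)"
proof -
  let ?k = "har_size f" and ?l = "har_size g" and ?t = "har_tensor n1 m1 n2 m2 f g"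
  note nm = is_har_interface_le[OF har(1)] is_har_interface_le[OF har(2)]
  note D1 = is_harD[OF har(1)] and D2 = is_harD[OF har(2)]
  obtain aM aL aR aN fM fL fR where f: "array_at h (R 2) (R 0) [?k, n1, m1, aM, aL, aR, aN]"
    "is_rows (har_mat f) fM" "rows_at h (R 2) aM fM"
    "is_rows (bool_to_nat_mat (har_left f)) fL" "rows_at h (R 2) aL fL"
    "is_rows (bool_to_nat_mat (har_right f)) fR" "rows_at h (R 2) aR fR"
    "array_at h (R 2) aN (map (node_code code) (har_lab f))"
    using f unfolding har_at_def sparse_mat_at_iff by blast
  obtain bM bL bR bN gM gL gR where g: "array_at h (R 2) (R 1) [?l, n2, m2, bM, bL, bR, bN]"
    "is_rows (har_mat g) gM" "rows_at h (R 2) bM gM"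
    "is_rows (bool_to_nat_mat (har_left g)) gL" "rows_at h (R 2) bL gL"
    "is_rows (bool_to_nat_mat (har_right g)) gR" "rows_at h (R 2) bR gR"
    "array_at h (R 2) bN (map (node_code code) (har_lab g))"
    using g unfolding har_at_def sparse_mat_at_iff by blast
  have car: "har_mat f \<in> carrier_mat ?k ?k" "har_left f \<in> carrier_mat ?k ?k" "har_right f \<in> carrier_mat ?k ?k"
    "har_mat g \<in> carrier_mat ?l ?l" "har_left g \<in> carrier_mat ?l ?l" "har_right g \<in> carrier_mat ?l ?l"
    using D1(1-3) D2(1-3) by (auto dest: permutation_mat_carrier)
  have len: "length fM = ?k" "length fL = ?k" "length fR = ?k" "length gM = ?l" "length gL = ?l" "length gR = ?l"
    using f g car by (auto simp: is_rows_def)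
  \<comment> \<open>Rows of the adjacency matrix are bounded by the arities, rows of the permutation
    matrices by 1, which is at most \<open>w\<close>.\<close>
  have cost: "(\<Sum>es\<leftarrow>ess. 12 * length es + 12) \<le> (12 * w + 12) * ?l" if "ess \<in> {gM, gL, gR}" for ess
  proof -
    have "length es \<le> w" if "es \<in> set gM" for es
      using length_row_le[OF g(2) that] is_har_row_card[OF har(2) fin] car w by auto
    moreover have "length es \<le> 1" if "es \<in> set gL" for es
      using length_row_le[OF g(4) that] permutation_mat_row_card[OF D2(2)] car by auto
    moreover have "length es \<le> 1" if "es \<in> set gR" for es
      using length_row_le[OF g(6) that] permutation_mat_row_card[OF D2(3)] car by auto
    ultimately have "\<forall>es\<in>set ess. length es \<le> w" "length ess = ?l" using that len w by fastforce+
    then show ?thesis using sum_list_row_cost_le by metis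
  qed
  define R0 where "R0 = R(3 := 1, 7 := ?k, 9 := n1, 10 := m1, 11 := aM, 12 := aL, 13 := aR, 0 := R 0 + 6, 14 := aN,
       8 := ?l, 15 := n2, 16 := m2, 17 := bM, 18 := bL, 19 := bR, 1 := R 1 + 6, 20 := bN)"
  have c0: "run load_headers (R, h) 27 (R0, h)"
    unfolding R0_def by (rule run_load_headers[OF f(1) g(1)])
  have R0: "R0 2 = R 2" "R0 3 = 1" "R0 7 = ?k" "R0 8 = ?l" "R0 9 = n1" "R0 10 = m1" "R0 11 = aM" "R0 12 = aL"
    "R0 13 = aR" "R0 14 = aN" "R0 15 = n2" "R0 16 = m2" "R0 17 = bM" "R0 18 = bL" "R0 19 = bR" "R0 20 = bN"
    by (simp_all add: R0_def)
  \<comment> \<open>Splitting both lists at their full lengths turns \<open>interleave\<close> into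
    concatenation, as the direct sum requires.\<close>
  have "\<exists>R' h'. run (stage 11 [Move 23 7, Move 24 8]) (R0, h)
      ((\<Sum>es\<leftarrow>gM. 12 * length es + 12) + 7 * (R0 7 + R0 8) + 19) (R', h') \<and>
    (\<forall>q<21. q \<notin> {2, 4, 5, 11} \<longrightarrow> R' q = R0 q) \<and> R0 2 \<le> R' 2 \<and> (\<forall>x<R0 2. h' x = h x) \<and>
    rows_at h' (R' 2) (R' 11) (interleave (R0 7) (R0 8) fM (map (shift (R0 7)) gM))"
    by (rule run_stage[of _ 7 8]) (use f g len nm in \<open>simp_all add: R0\<close>)
  then obtain R1 h1 where c1: "run (stage 11 [Move 23 7, Move 24 8]) (R0, h)
      ((\<Sum>es\<leftarrow>gM. 12 * length es + 12) + 7 * (R0 7 + R0 8) + 19) (R1, h1)"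
    and R1': "\<forall>q<21. q \<notin> {2, 4, 5, 11} \<longrightarrow> R1 q = R0 q" "R0 2 \<le> R1 2"
    and h1: "\<forall>x<R0 2. h1 x = h x"
    and M1: "rows_at h1 (R1 2) (R1 11) (interleave (R0 7) (R0 8) fM (map (shift (R0 7)) gM))" by blast
  have R1: "R1 3 = 1" "R1 7 = ?k" "R1 8 = ?l" "R1 9 = n1" "R1 10 = m1" "R1 12 = aL"
    "R1 13 = aR" "R1 14 = aN" "R1 15 = n2" "R1 16 = m2" "R1 18 = bL" "R1 19 = bR" "R1 20 = bN"
    using R1'(1) by (simp_all add: R0)
  have b1: "R 2 \<le> R1 2" and e1: "\<And>x. x < R 2 \<Longrightarrow> h1 x = h x" using R1'(2) h1 by (simp_all add: R0)
  have "\<exists>R' h'. run (stage 12 [Move 23 9, Move 24 15]) (R1, h1)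
      ((\<Sum>es\<leftarrow>gL. 12 * length es + 12) + 7 * (R1 7 + R1 8) + 19) (R', h') \<and>
    (\<forall>q<21. q \<notin> {2, 4, 5, 12} \<longrightarrow> R' q = R1 q) \<and> R1 2 \<le> R' 2 \<and> (\<forall>x<R1 2. h' x = h1 x) \<and>
    rows_at h' (R' 2) (R' 12) (interleave n1 n2 fL (map (shift (R1 7)) gL))"
    by (rule run_stage[of _ 9 15])
      (use len nm rows_at_mono[OF f(5) b1 e1] rows_at_mono[OF g(5) b1 e1] in \<open>simp_all add: R1\<close>)
  then obtain R2 h2 where c2: "run (stage 12 [Move 23 9, Move 24 15]) (R1, h1)
      ((\<Sum>es\<leftarrow>gL. 12 * length es + 12) + 7 * (R1 7 + R1 8) + 19) (R2, h2)"
    and R2': "\<forall>q<21. q \<notin> {2, 4, 5, 12} \<longrightarrow> R2 q = R1 q" "R1 2 \<le> R2 2"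
    and h2: "\<forall>x<R1 2. h2 x = h1 x"
    and L2: "rows_at h2 (R2 2) (R2 12) (interleave n1 n2 fL (map (shift (R1 7)) gL))" by blast
  have R2: "R2 3 = 1" "R2 7 = ?k" "R2 8 = ?l" "R2 9 = n1" "R2 10 = m1" "R2 11 = R1 11"
    "R2 13 = aR" "R2 14 = aN" "R2 15 = n2" "R2 16 = m2" "R2 19 = bR" "R2 20 = bN"
    using R2'(1) by (simp_all add: R1)
  have b2: "R 2 \<le> R2 2" and e2: "\<And>x. x < R 2 \<Longrightarrow> h2 x = h x" using R2'(2) b1 h2 e1 by simp_all
  have "\<exists>R' h'. run (stage 13 [Sub 23 7 10, Sub 24 8 16]) (R2, h2)
      ((\<Sum>es\<leftarrow>gR. 12 * length es + 12) + 7 * (R2 7 + R2 8) + 19) (R', h') \<and>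
    (\<forall>q<21. q \<notin> {2, 4, 5, 13} \<longrightarrow> R' q = R2 q) \<and> R2 2 \<le> R' 2 \<and> (\<forall>x<R2 2. h' x = h2 x) \<and>
    rows_at h' (R' 2) (R' 13) (interleave (?k - m1) (?l - m2) fR (map (shift (R2 7)) gR))"
    by (rule run_stage[of _ 10 16])
      (use len nm rows_at_mono[OF f(7) b2 e2] rows_at_mono[OF g(7) b2 e2] in \<open>simp_all add: R2\<close>)
  then obtain R3 h3 where c3: "run (stage 13 [Sub 23 7 10, Sub 24 8 16]) (R2, h2)
      ((\<Sum>es\<leftarrow>gR. 12 * length es + 12) + 7 * (R2 7 + R2 8) + 19) (R3, h3)"
    and R3': "\<forall>q<21. q \<notin> {2, 4, 5, 13} \<longrightarrow> R3 q = R2 q" "R2 2 \<le> R3 2"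
    and h3: "\<forall>x<R2 2. h3 x = h2 x"
    and R3r: "rows_at h3 (R3 2) (R3 13) (interleave (?k - m1) (?l - m2) fR (map (shift (R2 7)) gR))" by blast
  have R3: "R3 3 = 1" "R3 7 = ?k" "R3 8 = ?l" "R3 9 = n1" "R3 10 = m1" "R3 11 = R1 11" "R3 12 = R2 12"
    "R3 14 = aN" "R3 15 = n2" "R3 16 = m2" "R3 20 = bN"
    using R3'(1) by (simp_all add: R2)
  have b3: "R 2 \<le> R3 2" and e3: "\<And>x. x < R 2 \<Longrightarrow> h3 x = h x" using R3'(2) b2 h3 e2 by simp_all
  have "array_at h3 (R3 2) (R3 14) (map (node_code code) (har_lab f))" "length (map (node_code code) (har_lab f)) = R3 7"
    "array_at h3 (R3 2) (R3 20) (map (node_code code) (har_lab g))" "length (map (node_code code) (har_lab g)) = R3 8"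
    using array_at_mono[OF f(8) b3 e3] array_at_mono[OF g(8) b3 e3] D1(4) D2(4) by (simp_all add: R3)
  from run_copy_labels[OF this R3(1)] obtain R4 h4 where
    c4: "run copy_labels (R3, h3) (7 * (R3 7 + R3 8) + 6) (R4, h4)"
    and R4': "\<forall>q<14. q \<notin> {2, 4, 5} \<longrightarrow> R4 q = R3 q" "R4 15 = R3 15" "R4 16 = R3 16" "R3 2 \<le> R4 2"
    and h4: "\<forall>x<R3 2. h4 x = h3 x"
    and N4: "array_at h4 (R4 2) (R4 14) (map (node_code code) (har_lab f) @ map (node_code code) (har_lab g))"
    by blast
  have R4: "R4 3 = 1" "R4 7 = ?k" "R4 8 = ?l" "R4 9 = n1" "R4 10 = m1" "R4 11 = R1 11" "R4 12 = R2 12"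
    "R4 13 = R3 13" "R4 15 = n2" "R4 16 = m2"
    using R4' by (simp_all add: R3)
  let ?hdr = "[R4 7 + R4 8, R4 9 + R4 15, R4 10 + R4 16, R4 11, R4 12, R4 13, R4 14]"
  let ?R5 = "R4(7 := R4 7 + R4 8, 9 := R4 9 + R4 15, 10 := R4 10 + R4 16, 0 := R4 2, 2 := R4 2 + 6)"
  let ?h5 = "write_list h4 (R4 2) ?hdr" and ?b = "R4 2 + length ?hdr"
  have c5: "run write_header (R4, h4) 17 (?R5, ?h5)" by (rule run_write_header[of R4, OF R4(1)])
  \<comment> \<open>Each part of the result is known in the memory at the end of its own stage;
    \<open>b\<close> and \<open>e\<close> carry it over to the final memory.\<close>
  have b: "R1 2 \<le> ?b" "R2 2 \<le> ?b" "R3 2 \<le> ?b" "R4 2 \<le> ?b"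
    using R2'(2) R3'(2) R4'(4) by simp_all
  have e: "x < R1 2 \<Longrightarrow> ?h5 x = h1 x" "x < R2 2 \<Longrightarrow> ?h5 x = h2 x" "x < R3 2 \<Longrightarrow> ?h5 x = h3 x"
    "x < R4 2 \<Longrightarrow> ?h5 x = h4 x" for x
    using R2'(2) R3'(2) R4'(4) h2 h3 h4 by (simp_all add: write_list_below)
  have "har_at code ?h5 ?b (?R5 0) (n1 + n2) (m1 + m2) ?t"
  proof -
    have "array_at ?h5 ?b (?R5 0) [har_size ?t, n1 + n2, m1 + m2, R1 11, R2 12, R3 13, R4 14]"
      using array_at_write_list[of h4 "R4 2" ?hdr] by (simp add: R4 har_tensor_def)
    moreover have "is_rows (har_mat ?t) (interleave ?k ?l fM (map (shift ?k) gM))"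
      using is_rows_dsum[OF car(1) f(2) car(4) g(2)] len by (simp add: har_tensor_def interleave_def)
    then have "sparse_mat_at ?h5 ?b (R1 11) (har_mat ?t)"
      using rows_at_mono[OF M1 b(1) e(1)] unfolding sparse_mat_at_iff R0 by blast
    moreover have "is_rows (bool_to_nat_mat (har_left ?t)) (interleave n1 n2 fL (map (shift ?k) gL))"
      using is_rows_perm_tensor[OF D1(2) f(4) nm(1) D2(2) g(4) nm(3)] by (simp add: har_tensor_def)
    then have "sparse_mat_at ?h5 ?b (R2 12) (bool_to_nat_mat (har_left ?t))"
      using rows_at_mono[OF L2 b(2) e(2)] unfolding sparse_mat_at_iff R1 by blast
    \<comment> \<open>With \<open>k - m1\<close> as splitting point the block after it has size
      \<open>k - (k - m1)\<close>, which is \<open>m1\<close> because an interface is no larger than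
      the HAR; likewise for \<open>g\<close>.\<close>
    moreover have "is_rows (bool_to_nat_mat (har_right ?t))
        (interleave (?k - m1) (?l - m2) fR (map (shift ?k) gR))"
      using is_rows_perm_tensor[OF D1(3) f(6) _ D2(3) g(6), of "?k - m1" "?l - m2"] nm
      by (simp add: har_tensor_def)
    then have "sparse_mat_at ?h5 ?b (R3 13) (bool_to_nat_mat (har_right ?t))"
      using rows_at_mono[OF R3r b(3) e(3)] unfolding sparse_mat_at_iff R2 by blast
    moreover have "array_at ?h5 ?b (R4 14) (map (node_code code) (har_lab ?t))"
      using array_at_mono[OF N4 b(4) e(4)] by (simp add: har_tensor_def)
    ultimately show ?thesis unfolding har_at_def by blast
  qed
  moreover note run_Seq[OF c0 run_Seq[OF c1 run_Seq[OF c2 run_Seq[OF c3 run_Seq[OF c4 c5]]]],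
    folded tensor_program_def]
  \<comment> \<open>28 is 7 for each of four merges, three of pointers and one of labels; 107 is 27
    for loading, three times 19 for the stages, 6 for the labels and 17 for the header.\<close>
  moreover have "27 + ((\<Sum>es\<leftarrow>gM. 12 * length es + 12) + 7 * (R0 7 + R0 8) + 19 +
      ((\<Sum>es\<leftarrow>gL. 12 * length es + 12) + 7 * (R1 7 + R1 8) + 19 +
      ((\<Sum>es\<leftarrow>gR. 12 * length es + 12) + 7 * (R2 7 + R2 8) + 19 + (7 * (R3 7 + R3 8) + 6 + 17))))
     \<le> 3 * ((12 * w + 12) * ?l) + 28 * (?k + ?l) + 107"
    using cost[of gM] cost[of gL] cost[of gR] unfolding R0 R1 R2 R3 by simp
  ultimately show ?thesis by blast
qed

theorem proposition6p3:
  fixes \<Sigma> :: "'o signature"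
  assumes "finite (ops \<Sigma>)"
  shows "\<exists>p c. \<forall>code n1 m1 n2 m2 f g s.
     inj_on code (ops \<Sigma>) \<longrightarrow> is_har \<Sigma> n1 m1 f \<longrightarrow> is_har \<Sigma> n2 m2 g \<longrightarrow>
     tensor_input code n1 m1 n2 m2 f g s \<longrightarrow>
     (\<exists>s'. halts_within p s (c * max 1 (har_size f + har_size g)) s' \<and>
           har_output code (n1 + n2) (m1 + m2) (har_tensor n1 m1 n2 m2 f g) s')"
proof (rule exI[of _ "compile 0 tensor_program"],
    rule exI[of _ "3 * (12 * (1 + (\<Sum>o'\<in>ops \<Sigma>. arity \<Sigma> o')) + 12) + 28 + 107"], intro allI impI)
  fix code n1 m1 n2 m2 s and f g :: "'o har"
  define w where "w = 1 + (\<Sum>o'\<in>ops \<Sigma>. arity \<Sigma> o')"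
  assume har: "is_har \<Sigma> n1 m1 f" "is_har \<Sigma> n2 m2 g" and input: "tensor_input code n1 m1 n2 m2 f g s"
  obtain t R h b where run: "run tensor_program (reg s, mem s) t (R, h)"
    and t: "t \<le> 3 * ((12 * w + 12) * har_size g) + 28 * (har_size f + har_size g) + 107"
    and out: "har_at code h b (R 0) (n1 + n2) (m1 + m2) (har_tensor n1 m1 n2 m2 f g)"
    using run_tensor_program[OF har assms _ _ w_def] input unfolding tensor_input_def by blast
  let ?N = "max 1 (har_size f + har_size g)"
  \<comment> \<open>Since \<open>?N\<close> is at least 1, it also absorbs the additive constant,
    even when both HARs are empty.\<close>
  have "(12 * w + 12) * har_size g \<le> (12 * w + 12) * ?N" by (intro mult_le_mono) auto
  then have "t \<le> (3 * (12 * w + 12) + 28 + 107) * ?N"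
    using t by (simp add: algebra_simps max_def split: if_splits)
  then have "halts_within (compile 0 tensor_program) s
      ((3 * (12 * (1 + (\<Sum>o'\<in>ops \<Sigma>. arity \<Sigma> o')) + 12) + 28 + 107) * ?N)
      (at_pc (com_length tensor_program) (R, h))"
    using halts_within_compile[OF run] input unfolding tensor_input_def w_def by blast
  moreover have "har_output code (n1 + n2) (m1 + m2) (har_tensor n1 m1 n2 m2 f g)
      (at_pc (com_length tensor_program) (R, h))"
    using out by (auto simp: har_output_def)
  ultimately show "\<exists>s'. halts_within (compile 0 tensor_program) s
      ((3 * (12 * (1 + (\<Sum>o'\<in>ops \<Sigma>. arity \<Sigma> o')) + 12) + 28 + 107) * ?N) s' \<and>
      har_output code (n1 + n2) (m1 + m2) (har_tensor n1 m1 n2 m2 f g) s'" by blast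
qed

end
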